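(* Let $f,g,I$ and the stochastic oracles be as in the context, let $L=L_f\vee L_g$, $\mu=\mu_f\wedge\mu_g$, $L_H=(I_{xx}\vee I_{yy})+I_{xy}$, $\sigma^2=3\sqrt2\,\sigma_H^2+2\sigma_F^2$, let $K\ge1$ and let $C>0$ be an absolute constant. Put $A(K)=\sqrt{(K+1)(K+2)(2K+3)/6}$ and $D=\frac{\sigma}{C}\frac{A(K)}{\sqrt{\mathbb E\|z_0-z^*\|^2}}$ (where $\mathbb E\|z_0-z^*\|^2>0$). Run stochastic AG-OG (see context) with $\alpha_k=\frac{2}{k+2}$, $$\eta_k=\frac{k+2}{4L+D+2\sqrt{2+\sqrt2}\,L_H(k+2)}$$ and $z_{-1/2}=z_0^{\mathrm{ag}}=z_0$. Then $$\mathbb E\|z_K^{\mathrm{ag}}-z^*\|^2\le\left[\frac{8L}{\mu(K+1)^2}+\frac{7.4(1+C^2)L_H}{\mu(K+1)}\right]\mathbb E\|z_0-z^*\|^2+\frac{2\left(C+\frac1C\right)\sigma}{\mu\sqrt{K+1}}\sqrt{\mathbb E\|z_0-z^*\|^2}.$$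
   Context: Setting. $a\vee b=\max(a,b)$, $a\wedge b=\min(a,b)$, $\|\cdot\|$ is the Euclidean norm. $f:\mathbb R^n\to\mathbb R$ is $\mu_f$-strongly convex and $L_f$-smooth, $g:\mathbb R^m\to\mathbb R$ is $\mu_g$-strongly convex and $L_g$-smooth ($\mu_f,\mu_g>0$; $L$-smooth means differentiable with $L$-Lipschitz gradient). $I:\mathbb R^n\times\mathbb R^m\to\mathbb R$ is smooth, convex in $x$ and concave in $y$, with blockwise smoothness parameters: in operator norm, $\|\nabla^2_{xx}I\|\le I_{xx}$, $\|\nabla^2_{xy}I\|\le I_{xy}$, $\|\nabla^2_{yy}I\|\le I_{yy}$ everywhere. The problem is $\min_x\max_yf(x)+I(x,y)-g(y)$. Write $z=[x;y]$, $F(z)=f(x)+g(y)$, $H(z)=[\nabla_xI(x,y);-\nabla_yI(x,y)]$; $z^*$ is the unique saddle point, i.e. the unique point with $\nabla F(z^* )+H(z^* )=0$. Stochastic oracles: $\tilde H(z;\zeta)$ and $\nabla\tilde F(z;\xi)$ are unbiased for $H(z)$ and $\nabla F(z)$, with $\mathbb E\|\tilde H(z;\zeta)-H(z)\|^2\le\sigma_H^2$ and $\mathbb E\|\nabla\tilde F(z;\xi)-\nabla F(z)\|^2\le\sigma_F^2$ for every $z$. The noise variables $\zeta_{-1/2},\xi_0,\zeta_{1/2},\xi_1,\zeta_{3/2},\dots$ are independent of each other and of the (possibly random, square-integrable) initial point $z_0$. Stochastic AG-OG: for $k=0,\dots,K-1$, $z_k^{\mathrm{md}}=(1-\alpha_k)z_k^{\mathrm{ag}}+\alpha_kz_k$;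 $z_{k+1/2}=z_k-\eta_k\big(\tilde H(z_{k-1/2};\zeta_{k-1/2})+\nabla\tilde F(z_k^{\mathrm{md}};\xi_k)\big)$; $z_{k+1}^{\mathrm{ag}}=(1-\alpha_k)z_k^{\mathrm{ag}}+\alpha_kz_{k+1/2}$; $z_{k+1}=z_k-\eta_k\big(\tilde H(z_{k+1/2};\zeta_{k+1/2})+\nabla\tilde F(z_k^{\mathrm{md}};\xi_k)\big)$. The same sample of $\tilde H(z_{k+1/2};\zeta_{k+1/2})$ is used in the step defining $z_{k+1}$ and in the step defining $z_{k+3/2}$. Output: $z_K^{\mathrm{ag}}$. *)

theory Defs
  imports "HOL-Probability.Probability"
begin

definition grad :: "('a::real_inner \<Rightarrow> real) \<Rightarrow> 'a \<Rightarrow> 'a" where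
  "grad f x = (THE D. GDERIV f x :> D)"

definition strongly_convex :: "real \<Rightarrow> ('a::real_inner \<Rightarrow> real) \<Rightarrow> bool" where
  "strongly_convex \<mu> f \<longleftrightarrow>
     (\<forall>x y t. 0 \<le> t \<and> t \<le> 1 \<longrightarrow>
        f ((1 - t) *\<^sub>R x + t *\<^sub>R y)
          \<le> (1 - t) * f x + t * f y - \<mu> / 2 * t * (1 - t) * (norm (x - y))\<^sup>2)"

definition smooth_fun :: "real \<Rightarrow> ('a::real_inner \<Rightarrow> real) \<Rightarrow> bool" where
  "smooth_fun L f \<longleftrightarrow> (\<forall>x. f differentiable (at x)) \<and> L-lipschitz_on UNIV (grad f)"

text \<open>Joint (Frechet) differentiability; the second derivative is not required to be continuous.\<close>

definition twice_differentiable :: "('a::real_inner \<Rightarrow> real) \<Rightarrow> bool" where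
  "twice_differentiable f \<longleftrightarrow>
     (\<forall>z. f differentiable (at z)) \<and> (\<forall>z. grad f differentiable (at z))"

definition grad_x :: "('a::real_inner \<times> 'b::real_inner \<Rightarrow> real) \<Rightarrow> 'a \<Rightarrow> 'b \<Rightarrow> 'a" where
  "grad_x I x y = grad (\<lambda>x'. I (x', y)) x"

definition grad_y :: "('a::real_inner \<times> 'b::real_inner \<Rightarrow> real) \<Rightarrow> 'a \<Rightarrow> 'b \<Rightarrow> 'b" where
  "grad_y I x y = grad (\<lambda>y'. I (x, y')) y"

text \<open>The Hessian blocks, as linear maps. The block \<open>hess_xy\<close> has the entries
  \<open>\<partial>\<^sup>2 I / \<partial>x\<^sub>i \<partial>y\<^sub>j\<close>, so it maps the space of \<open>y\<close> to the space of \<open>x\<close>.\<close>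

definition hess_xx ::
    "('a::real_inner \<times> 'b::real_inner \<Rightarrow> real) \<Rightarrow> 'a \<Rightarrow> 'b \<Rightarrow> 'a \<Rightarrow> 'a" where
  "hess_xx I x y = frechet_derivative (\<lambda>x'. grad_x I x' y) (at x)"

definition hess_xy ::
    "('a::real_inner \<times> 'b::real_inner \<Rightarrow> real) \<Rightarrow> 'a \<Rightarrow> 'b \<Rightarrow> 'b \<Rightarrow> 'a" where
  "hess_xy I x y = frechet_derivative (\<lambda>y'. grad_x I x y') (at y)"

definition hess_yy ::
    "('a::real_inner \<times> 'b::real_inner \<Rightarrow> real) \<Rightarrow> 'a \<Rightarrow> 'b \<Rightarrow> 'b \<Rightarrow> 'b" where
  "hess_yy I x y = frechet_derivative (\<lambda>y'. grad_y I x y') (at y)"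

definition sep_sum ::
    "('a \<Rightarrow> real) \<Rightarrow> ('b \<Rightarrow> real) \<Rightarrow> 'a \<times> 'b \<Rightarrow> real" where
  "sep_sum f g z = f (fst z) + g (snd z)"

definition coupling_op ::
    "('a::real_inner \<times> 'b::real_inner \<Rightarrow> real) \<Rightarrow> 'a \<times> 'b \<Rightarrow> 'a \<times> 'b" where
  "coupling_op I z = (grad_x I (fst z) (snd z), - grad_y I (fst z) (snd z))"

text \<open>The noise variable \<open>s\<close> has values in the measurable space \<open>S\<close>. The integrability
  conditions are what makes the two (Bochner) expectations meaningful.\<close>

definition unbiased_oracle ::
    "'w measure \<Rightarrow> 's measure \<Rightarrow> ('w \<Rightarrow> 's) \<Rightarrow> ('z::euclidean_space \<Rightarrow> 's \<Rightarrow> 'z)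
      \<Rightarrow> ('z \<Rightarrow> 'z) \<Rightarrow> real \<Rightarrow> bool" where
  "unbiased_oracle M S s Gt G \<sigma> \<longleftrightarrow>
     s \<in> M \<rightarrow>\<^sub>M S \<and>
     (\<lambda>(z, a). Gt z a) \<in> borel \<Otimes>\<^sub>M S \<rightarrow>\<^sub>M borel \<and>
     (\<forall>z. integrable M (\<lambda>\<omega>. Gt z (s \<omega>)) \<and>
          (\<integral>\<omega>. Gt z (s \<omega>) \<partial>M) = G z \<and>
          integrable M (\<lambda>\<omega>. (norm (Gt z (s \<omega>) - G z))\<^sup>2) \<and>
          (\<integral>\<omega>. (norm (Gt z (s \<omega>) - G z))\<^sup>2 \<partial>M) \<le> \<sigma>\<^sup>2)"

text \<open>Half-integer indices are shifted by one half: \<open>\<zeta> k\<close> stands for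
  \<open>\<zeta>\<^bsub>k-1/2\<^esub>\<close> and, below, \<open>zh k\<close> stands for \<open>z\<^bsub>k-1/2\<^esub>\<close>, for \<open>k = 0, 1, 2, \<dots>\<close>.

  The library's \<open>indep_vars\<close> needs all variables of a family to have the same value type;
  the following is its definition for the joint family of the initial point, the
  \<open>\<zeta> k\<close> and the \<open>\<xi> k\<close>, which have three different value types.\<close>

datatype source = Init | OpNoise nat | GradNoise nat

definition indep_sources ::
    "'w measure \<Rightarrow> ('w \<Rightarrow> 'z::topological_space)
      \<Rightarrow> 's measure \<Rightarrow> (nat \<Rightarrow> 'w \<Rightarrow> 's) \<Rightarrow> 't measure \<Rightarrow> (nat \<Rightarrow> 'w \<Rightarrow> 't) \<Rightarrow> bool" where
  "indep_sources M z0 S \<zeta> T \<xi> \<longleftrightarrow>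
     z0 \<in> M \<rightarrow>\<^sub>M borel \<and> (\<forall>k. \<zeta> k \<in> M \<rightarrow>\<^sub>M S) \<and> (\<forall>k. \<xi> k \<in> M \<rightarrow>\<^sub>M T) \<and>
     prob_space.indep_sets M
       (\<lambda>i. case i of
              Init \<Rightarrow> {z0 -` A \<inter> space M |A. A \<in> sets borel}
            | OpNoise k \<Rightarrow> {\<zeta> k -` A \<inter> space M |A. A \<in> sets S}
            | GradNoise k \<Rightarrow> {\<xi> k -` A \<inter> space M |A. A \<in> sets T})
       UNIV"

text \<open>One realisation of \<open>K\<close> steps, started at \<open>z\<^bsub>-1/2\<^esub> = z\<^bsup>ag\<^esup>\<^sub>0 = z\<^sub>0\<close>.\<close>

definition ag_og_run ::
    "nat \<Rightarrow> (nat \<Rightarrow> real) \<Rightarrow> (nat \<Rightarrow> real)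
      \<Rightarrow> ('z::real_vector \<Rightarrow> 's \<Rightarrow> 'z) \<Rightarrow> ('z \<Rightarrow> 't \<Rightarrow> 'z) \<Rightarrow> (nat \<Rightarrow> 's) \<Rightarrow> (nat \<Rightarrow> 't)
      \<Rightarrow> (nat \<Rightarrow> 'z) \<Rightarrow> (nat \<Rightarrow> 'z) \<Rightarrow> (nat \<Rightarrow> 'z) \<Rightarrow> (nat \<Rightarrow> 'z) \<Rightarrow> bool" where
  "ag_og_run K \<alpha> \<eta> Ht Ft \<zeta> \<xi> z zh zag zmd \<longleftrightarrow>
     zh 0 = z 0 \<and> zag 0 = z 0 \<and>
     (\<forall>k<K.
        zmd k = (1 - \<alpha> k) *\<^sub>R zag k + \<alpha> k *\<^sub>R z k \<and>
        zh (Suc k) = z k - \<eta> k *\<^sub>R (Ht (zh k) (\<zeta> k) + Ft (zmd k) (\<xi> k)) \<and>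
        zag (Suc k) = (1 - \<alpha> k) *\<^sub>R zag k + \<alpha> k *\<^sub>R zh (Suc k) \<and>
        z (Suc k) = z k - \<eta> k *\<^sub>R (Ht (zh (Suc k)) (\<zeta> (Suc k)) + Ft (zmd k) (\<xi> k)))"

end

theory Submission
  imports Defs
begin

text \<open>
  Let \<open>Q w = F w - F z* + H z* \<bullet> (w - z*)\<close>; strong convexity gives \<open>\<mu>/2 \<parallel>w - z*\<parallel>\<^sup>2 \<le> Q w\<close>. The descent lemma,
  convexity and monotonicity of \<open>H\<close> combine with the exact extragradient identity to a one-step
  inequality for \<open>(k + 2) \<eta>\<^sub>k Q z\<^sup>a\<^sup>g + \<parallel>z - z*\<parallel>\<^sup>2\<close>; in this normalisation the
  squared distance has weight one, and the steps chain because \<open>(k + 1) \<eta>\<^bsub>k+1\<^esub> \<le> (k + 2) \<eta>\<^sub>k\<close>. The gradient noise contributes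
  exactly \<open>2 \<eta>\<^sub>k\<^sup>2 \<sigma>\<^sub>F\<^sup>2\<close>, because the half step depends on it linearly, and the operator noise is
  orthogonal to the past. The difference of consecutive operator samples is contracted by a factor
  \<open>(2 - sqrt 2) / 2\<close> per step, so adding it to the potential with weight \<open>sqrt 2 - 1\<close> makes the potential
  grow by at most \<open>\<sigma>\<^sup>2 \<eta>\<^sub>k\<^sup>2\<close>. The choice of \<open>D\<close> bounds the sum of these increments by \<open>C\<^sup>2 E\<parallel>z\<^sub>0 - z*\<parallel>\<^sup>2\<close>.
\<close>

section \<open>Strong convexity and smoothness\<close>

lemma grad_eqI: "GDERIV f x :> D \<Longrightarrow> grad f x = D"
  unfolding grad_def
proof (rule the_equality)
  fix E assume "GDERIV f x :> D" "GDERIV f x :> E"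
  then have "(\<lambda>h. h \<bullet> D) = (\<lambda>h. h \<bullet> E)"
    unfolding gderiv_def by (rule has_derivative_unique)
  then show "E = D" by (metis vector_eq_ldot)
qed

text \<open>Riesz representation: a linear functional on a Euclidean space is the inner product with
  its adjoint evaluated at 1. Hence the definite description in \<open>grad\<close> really denotes a
  gradient.\<close>

lemma GDERIV_grad:
  fixes f :: "'a::euclidean_space \<Rightarrow> real"
  assumes "f differentiable (at x)"
  shows "GDERIV f x :> grad f x"
proof -
  obtain f' where f': "(f has_derivative f') (at x)"
    using assms by (auto simp: differentiable_def)
  have "f' = (\<lambda>h. h \<bullet> adjoint f' 1)"
    using adjoint_works[OF has_derivative_linear[OF f'], of _ 1] by auto
  with f' have "GDERIV f x :> adjoint f' 1"
    by (simp add: gderiv_def)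
  then show ?thesis using grad_eqI by metis
qed

lemma GDERIV_line:
  fixes f :: "'a::real_inner \<Rightarrow> real"
  assumes "GDERIV f (x + t *\<^sub>R d) :> D"
  shows "((\<lambda>t. f (x + t *\<^sub>R d)) has_real_derivative (D \<bullet> d)) (at t)"
proof -
  have "((\<lambda>t. x + t *\<^sub>R d) has_derivative (\<lambda>s. s *\<^sub>R d)) (at t)"
    by (auto intro!: derivative_eq_intros)
  from has_derivative_compose[OF this assms[unfolded gderiv_def]]
  have "((\<lambda>t. f (x + t *\<^sub>R d)) has_derivative (\<lambda>s. s * (D \<bullet> d))) (at t)"
    by (simp add: inner_commute)
  then show ?thesis
    unfolding has_field_derivative_def mult.commute[of "D \<bullet> d"] .
qed

lemma GDERIV_fst:
  fixes f :: "'a::real_inner \<times> 'b::real_inner \<Rightarrow> real"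
  assumes "GDERIV f (x, y) :> D"
  shows "GDERIV (\<lambda>x'. f (x', y)) x :> fst D"
proof -
  have "((\<lambda>x'. (x', y)) has_derivative (\<lambda>h. (h, 0))) (at x)"
    by (auto intro!: derivative_eq_intros)
  from has_derivative_compose[OF this assms[unfolded gderiv_def]]
  show ?thesis by (simp add: gderiv_def inner_prod_def)
qed

lemma GDERIV_snd:
  fixes f :: "'a::real_inner \<times> 'b::real_inner \<Rightarrow> real"
  assumes "GDERIV f (x, y) :> D"
  shows "GDERIV (\<lambda>y'. f (x, y')) y :> snd D"
proof -
  have "((\<lambda>y'. (x, y')) has_derivative (\<lambda>h. (0, h))) (at y)"
    by (auto intro!: derivative_eq_intros)
  from has_derivative_compose[OF this assms[unfolded gderiv_def]]
  show ?thesis by (simp add: gderiv_def inner_prod_def)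
qed

lemma GDERIV_sep_sum:
  assumes "GDERIV f (fst z) :> a" "GDERIV g (snd z) :> b"
  shows "GDERIV (sep_sum f g) z :> (a, b)"
proof -
  have "((\<lambda>z. f (fst z)) has_derivative (\<lambda>h. fst h \<bullet> a)) (at z)"
    by (rule has_derivative_compose[OF has_derivative_fst[OF has_derivative_ident] assms(1)[unfolded gderiv_def]])
  moreover have "((\<lambda>z. g (snd z)) has_derivative (\<lambda>h. snd h \<bullet> b)) (at z)"
    by (rule has_derivative_compose[OF has_derivative_snd[OF has_derivative_ident] assms(2)[unfolded gderiv_def]])
  ultimately show ?thesis
    by (simp add: gderiv_def sep_sum_def[abs_def] inner_prod_def has_derivative_add)
qed

text \<open>The convexity inequality bounds the difference quotient at \<open>x\<close> along the
  segment to \<open>y\<close>; letting \<open>t\<close> tend to 0 from the right gives the tangent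
  bound. \<open>D\<close> is kept general so that partial functions and negated ones are
  covered.\<close>

lemma strongly_convex_lower_bound:
  fixes f :: "'a::real_inner \<Rightarrow> real"
  assumes sc: "strongly_convex \<mu> f" and D: "GDERIV f x :> D"
  shows "f x + D \<bullet> (y - x) + \<mu> / 2 * (norm (y - x))\<^sup>2 \<le> f y"
proof -
  define \<phi> where "\<phi> t = f (x + t *\<^sub>R (y - x))" for t
  have "(\<phi> has_real_derivative (D \<bullet> (y - x))) (at 0)"
    unfolding \<phi>_def using D by (intro GDERIV_line) simp
  then have "((\<lambda>t. (\<phi> t - \<phi> 0) / t) \<longlongrightarrow> D \<bullet> (y - x)) (at_right 0)"
    using tendsto_mono[OF at_le[of "{0<..}" UNIV 0]]
    by (fastforce simp: has_field_derivative_iff)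
  moreover have "((\<lambda>t. f y - f x - \<mu> / 2 * (1 - t) * (norm (y - x))\<^sup>2) \<longlongrightarrow>
      f y - f x - \<mu> / 2 * (1 - 0) * (norm (y - x))\<^sup>2) (at_right 0)"
    by (intro tendsto_intros)
  moreover have "\<forall>\<^sub>F t in at_right 0. (\<phi> t - \<phi> 0) / t \<le> f y - f x - \<mu> / 2 * (1 - t) * (norm (y - x))\<^sup>2"
    using eventually_at_right_less[of 0] eventually_at_right_real[of 0 1, simplified]
  proof eventually_elim
    case (elim t)
    have "\<phi> t = f ((1 - t) *\<^sub>R x + t *\<^sub>R y)"
      by (simp add: \<phi>_def algebra_simps)
    also have "\<dots> \<le> (1 - t) * f x + t * f y - \<mu> / 2 * t * (1 - t) * (norm (y - x))\<^sup>2"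
      using sc elim unfolding strongly_convex_def by (auto simp: norm_minus_commute)
    finally have "\<phi> t - \<phi> 0 \<le> t * (f y - f x - \<mu> / 2 * (1 - t) * (norm (y - x))\<^sup>2)"
      by (simp add: \<phi>_def algebra_simps)
    then show ?case using elim by (simp add: divide_le_eq mult.commute)
  qed
  ultimately have "D \<bullet> (y - x) \<le> f y - f x - \<mu> / 2 * (1 - 0) * (norm (y - x))\<^sup>2"
    by (intro tendsto_le[OF trivial_limit_at_right_real])
  then show ?thesis by simp
qed

text \<open>Modulus 0 makes the tangent bound available for mere convexity, as assumed of
  \<open>I\<close> in \<open>x\<close> and of its negative in \<open>y\<close>.\<close>

lemma convex_on_strongly_convex_0:
  assumes "convex_on UNIV f"
  shows "strongly_convex 0 f"
  unfolding strongly_convex_def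
proof (intro allI impI)
  fix x y and t :: real
  assume t: "0 \<le> t \<and> t \<le> 1"
  have "f ((1 - t) *\<^sub>R x + t *\<^sub>R y) \<le> (1 - t) * f x + t * f y"
    using convex_onD[OF assms, of t x y] t by simp
  then show "f ((1 - t) *\<^sub>R x + t *\<^sub>R y)
       \<le> (1 - t) * f x + t * f y - 0 / 2 * t * (1 - t) * (norm (x - y))\<^sup>2"
    by simp
qed

text \<open>\<open>\<phi>\<close> is \<open>f\<close> on the segment minus the linear and quadratic
  terms of the model. Cauchy-Schwarz and the Lipschitz gradient make its derivative nonpositive on
  the unit interval, so monotonicity replaces an integral.\<close>

lemma descent_lemma:
  fixes f :: "'a::euclidean_space \<Rightarrow> real"
  assumes "smooth_fun L f"
  shows "f y \<le> f x + grad f x \<bullet> (y - x) + L / 2 * (norm (y - x))\<^sup>2"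
proof -
  let ?d = "y - x"
  define \<phi> where "\<phi> t = f (x + t *\<^sub>R ?d) - t * (grad f x \<bullet> ?d) - L / 2 * t\<^sup>2 * (norm ?d)\<^sup>2" for t
  have lip: "L-lipschitz_on UNIV (grad f)"
    and G: "\<And>x. GDERIV f x :> grad f x"
    using assms by (auto simp: smooth_fun_def intro: GDERIV_grad)
  have d: "(\<phi> has_real_derivative
      (grad f (x + t *\<^sub>R ?d) \<bullet> ?d - grad f x \<bullet> ?d - L * t * (norm ?d)\<^sup>2)) (at t)" for t
    unfolding \<phi>_def by (rule derivative_eq_intros GDERIV_line G refl | simp)+
  have "\<phi> 1 \<le> \<phi> 0"
  proof (rule DERIV_nonpos_imp_nonincreasing[where f = \<phi>])
    fix t :: real assume t: "0 \<le> t" "t \<le> 1"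
    have "(grad f (x + t *\<^sub>R ?d) - grad f x) \<bullet> ?d \<le> norm (grad f (x + t *\<^sub>R ?d) - grad f x) * norm ?d"
      by (rule norm_cauchy_schwarz)
    also have "\<dots> \<le> (L * norm (t *\<^sub>R ?d)) * norm ?d"
      using lipschitz_onD[OF lip, of "x + t *\<^sub>R ?d" x] by (intro mult_right_mono) (auto simp: dist_norm)
    also have "\<dots> = L * t * (norm ?d)\<^sup>2"
      using t by (simp add: power2_eq_square)
    finally show "\<exists>D. (\<phi> has_real_derivative D) (at t) \<and> D \<le> 0"
      using d[of t] by (auto simp: inner_diff_left)
  qed simp
  then show ?thesis by (simp add: \<phi>_def)
qed

lemma strongly_convex_sep_sum:
  fixes f :: "'a::real_inner \<Rightarrow> real" and g :: "'b::real_inner \<Rightarrow> real"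
  assumes "strongly_convex \<mu>f f" "strongly_convex \<mu>g g" "\<mu> \<le> \<mu>f" "\<mu> \<le> \<mu>g"
  shows "strongly_convex \<mu> (sep_sum f g)"
  unfolding strongly_convex_def
proof (intro allI impI)
  fix u v :: "'a \<times> 'b" and t :: real
  assume t: "0 \<le> t \<and> t \<le> 1"
  let ?s = "1 / 2 * t * (1 - t)"
  have s: "0 \<le> ?s" using t by simp
  have f: "f (fst ((1 - t) *\<^sub>R u + t *\<^sub>R v)) \<le> (1 - t) * f (fst u) + t * f (fst v) - \<mu>f * (?s * (norm (fst u - fst v))\<^sup>2)"
    using assms(1)[unfolded strongly_convex_def, rule_format, OF t, of "fst u" "fst v"]
    by (simp add: mult_ac)
  have g: "g (snd ((1 - t) *\<^sub>R u + t *\<^sub>R v)) \<le> (1 - t) * g (snd u) + t * g (snd v) - \<mu>g * (?s * (norm (snd u - snd v))\<^sup>2)"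
    using assms(2)[unfolded strongly_convex_def, rule_format, OF t, of "snd u" "snd v"]
    by (simp add: mult_ac)
  have "\<mu> * (?s * (norm (fst u - fst v))\<^sup>2) \<le> \<mu>f * (?s * (norm (fst u - fst v))\<^sup>2)"
       "\<mu> * (?s * (norm (snd u - snd v))\<^sup>2) \<le> \<mu>g * (?s * (norm (snd u - snd v))\<^sup>2)"
    using assms s by (auto intro!: mult_right_mono mult_nonneg_nonneg[OF s])
  moreover have "\<mu> / 2 * t * (1 - t) * (norm (u - v))\<^sup>2
      = \<mu> * (?s * (norm (fst u - fst v))\<^sup>2) + \<mu> * (?s * (norm (snd u - snd v))\<^sup>2)"
    by (simp add: norm_prod_def field_simps)
  moreover have "(1 - t) * sep_sum f g u + t * sep_sum f g v
      = ((1 - t) * f (fst u) + t * f (fst v)) + ((1 - t) * g (snd u) + t * g (snd v))"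
    by (simp add: sep_sum_def algebra_simps)
  ultimately show "sep_sum f g ((1 - t) *\<^sub>R u + t *\<^sub>R v)
       \<le> (1 - t) * sep_sum f g u + t * sep_sum f g v - \<mu> / 2 * t * (1 - t) * (norm (u - v))\<^sup>2"
    using f g unfolding sep_sum_def[of f g "_ + _"] by linarith
qed

text \<open>The gradient acts on the two blocks separately, so squared block bounds add in the
  product norm and the constant is a maximum, not a sum.\<close>

lemma smooth_fun_sep_sum:
  fixes f :: "'a::euclidean_space \<Rightarrow> real" and g :: "'b::euclidean_space \<Rightarrow> real"
  assumes f: "smooth_fun Lf f" and g: "smooth_fun Lg g"
  shows "smooth_fun (max Lf Lg) (sep_sum f g)"
proof -
  let ?L = "max Lf Lg"
  have G: "GDERIV (sep_sum f g) z :> (grad f (fst z), grad g (snd z))" for z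
    using f g by (auto simp: smooth_fun_def intro!: GDERIV_sep_sum GDERIV_grad)
  have L: "0 \<le> Lf" "0 \<le> Lg"
    using f g lipschitz_on_nonneg by (auto simp: smooth_fun_def)
  have "?L-lipschitz_on UNIV (grad (sep_sum f g))"
  proof (rule lipschitz_onI)
    fix u v :: "'a \<times> 'b"
    have a: "norm (grad f (fst u) - grad f (fst v)) \<le> ?L * norm (fst u - fst v)"
      using lipschitz_onD[of Lf UNIV "grad f" "fst u" "fst v"] f
        mult_right_mono[of Lf ?L "norm (fst u - fst v)"]
      by (auto simp: smooth_fun_def dist_norm)
    have b: "norm (grad g (snd u) - grad g (snd v)) \<le> ?L * norm (snd u - snd v)"
      using lipschitz_onD[of Lg UNIV "grad g" "snd u" "snd v"] g
        mult_right_mono[of Lg ?L "norm (snd u - snd v)"]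
      by (auto simp: smooth_fun_def dist_norm)
    have "norm (grad (sep_sum f g) u - grad (sep_sum f g) v)
        = sqrt ((norm (grad f (fst u) - grad f (fst v)))\<^sup>2 + (norm (grad g (snd u) - grad g (snd v)))\<^sup>2)"
      by (simp add: grad_eqI[OF G] norm_prod_def)
    also have "\<dots> \<le> sqrt ((?L * norm (fst u - fst v))\<^sup>2 + (?L * norm (snd u - snd v))\<^sup>2)"
      using a b by (intro real_sqrt_le_mono add_mono power_mono) auto
    also have "\<dots> = ?L * norm (u - v)"
      using L by (simp add: norm_prod_def power_mult_distrib distrib_left[symmetric] real_sqrt_mult)
    finally show "dist (grad (sep_sum f g) u) (grad (sep_sum f g) v) \<le> ?L * dist u v"
      by (simp add: dist_norm)
  qed (use L in auto)
  then show ?thesis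
    using G unfolding smooth_fun_def gderiv_def differentiable_def by blast
qed

text \<open>At a unit vector the tangent lower bound and the quadratic upper bound leave
  \<open>\<mu> / 2\<close> against \<open>L / 2\<close>. This later yields \<open>0 < L\<close>,
  which keeps the step-size denominators positive.\<close>

lemma strong_convexity_le_smoothness:
  fixes f :: "'a::euclidean_space \<Rightarrow> real"
  assumes "strongly_convex \<mu> f" "smooth_fun L f"
  shows "\<mu> \<le> L"
proof -
  obtain b :: 'a where b: "b \<in> Basis" using nonempty_Basis by blast
  have "GDERIV f 0 :> grad f 0"
    using assms(2) by (auto simp: smooth_fun_def intro: GDERIV_grad)
  from strongly_convex_lower_bound[OF assms(1) this, of b] descent_lemma[OF assms(2), of b 0]
  show ?thesis using b by simp
qed

section \<open>The coupling operator\<close>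

text \<open>The derivative in the direction \<open>D\<close> itself is \<open>D \<bullet> D\<close>,
  while the increments bound it by \<open>B * norm D\<close>.\<close>

lemma norm_GDERIV_le:
  fixes f :: "'a::euclidean_space \<Rightarrow> real"
  assumes D: "GDERIV f x :> D" and B: "\<And>v. \<bar>f (x + v) - f x\<bar> \<le> B * norm v"
  shows "norm D \<le> B"
proof (cases "D = 0")
  case True
  obtain b :: 'a where "b \<in> Basis" using nonempty_Basis by blast
  then have "0 \<le> B" using order_trans[OF abs_ge_zero B[of b]] by simp
  then show ?thesis using True by simp
next
  case False
  have "((\<lambda>t. f (x + t *\<^sub>R D)) has_real_derivative (D \<bullet> D)) (at 0)"
    using D by (intro GDERIV_line) simp
  then have "((\<lambda>t. (f (x + t *\<^sub>R D) - f x) / t) \<longlongrightarrow> D \<bullet> D) (at 0)"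
    by (simp add: has_field_derivative_iff)
  moreover have "\<forall>\<^sub>F t in at 0. (f (x + t *\<^sub>R D) - f x) / t \<le> B * norm D"
    unfolding eventually_at_filter
  proof (intro always_eventually allI impI)
    fix t :: real assume "t \<noteq> 0"
    have "(f (x + t *\<^sub>R D) - f x) / t \<le> \<bar>f (x + t *\<^sub>R D) - f x\<bar> / \<bar>t\<bar>"
      by (metis abs_divide abs_ge_self)
    also have "\<dots> \<le> B * norm D"
      using B[of "t *\<^sub>R D"] \<open>t \<noteq> 0\<close> by (simp add: divide_le_eq mult_ac)
    finally show "(f (x + t *\<^sub>R D) - f x) / t \<le> B * norm D" .
  qed
  ultimately have "D \<bullet> D \<le> B * norm D"
    by (intro tendsto_upperbound) auto
  then show ?thesis using False by (simp add: dot_square_norm power2_eq_square)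
qed

section \<open>Partial gradients and Hessian blocks of the coupling\<close>

context
  fixes I :: "('a::euclidean_space) \<times> ('b::euclidean_space) \<Rightarrow> real"
  assumes I: "twice_differentiable I"
begin

lemma GDERIV_grad_x: "GDERIV (\<lambda>x'. I (x', y)) x :> grad_x I x y"
  and grad_x_eq: "grad_x I x y = fst (grad I (x, y))"
proof -
  have "GDERIV (\<lambda>x'. I (x', y)) x :> fst (grad I (x, y))"
    using I by (intro GDERIV_fst GDERIV_grad) (auto simp: twice_differentiable_def)
  then show "GDERIV (\<lambda>x'. I (x', y)) x :> grad_x I x y" "grad_x I x y = fst (grad I (x, y))"
    using grad_eqI[of "\<lambda>x'. I (x', y)" x] unfolding grad_x_def by auto
qed

lemma GDERIV_grad_y: "GDERIV (\<lambda>y'. I (x, y')) y :> grad_y I x y"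
  and grad_y_eq: "grad_y I x y = snd (grad I (x, y))"
proof -
  have "GDERIV (\<lambda>y'. I (x, y')) y :> snd (grad I (x, y))"
    using I by (intro GDERIV_snd GDERIV_grad) (auto simp: twice_differentiable_def)
  then show "GDERIV (\<lambda>y'. I (x, y')) y :> grad_y I x y" "grad_y I x y = snd (grad I (x, y))"
    using grad_eqI[of "\<lambda>y'. I (x, y')" y] unfolding grad_y_def by auto
qed

text \<open>\<open>frechet_derivative\<close> is meaningful only where a derivative exists.
  Existence comes from the joint differentiability of \<open>grad I\<close>, composed with the
  affine slices in \<open>x\<close> and in \<open>y\<close>.\<close>

lemma has_derivative_hess:
  shows "((\<lambda>x'. grad_x I x' y) has_derivative hess_xx I x y) (at x)"
    and "((\<lambda>y'. grad_x I x y') has_derivative hess_xy I x y) (at y)"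
    and "((\<lambda>y'. grad_y I x y') has_derivative hess_yy I x y) (at y)"
proof -
  obtain G' where G': "(grad I has_derivative G') (at (x, y))"
    using I unfolding twice_differentiable_def differentiable_def by blast
  have 1: "((\<lambda>x'. (x', y)) has_derivative (\<lambda>h. (h, 0))) (at x)"
    by (auto intro!: derivative_eq_intros)
  have 2: "((\<lambda>y'. (x, y')) has_derivative (\<lambda>h. (0, h))) (at y)"
    by (auto intro!: derivative_eq_intros)
  note 1 = has_derivative_compose[OF 1 G'] and 2 = has_derivative_compose[OF 2 G']
  have "(\<lambda>x'. grad_x I x' y) differentiable (at x)"
    "(\<lambda>y'. grad_x I x y') differentiable (at y)"
    "(\<lambda>y'. grad_y I x y') differentiable (at y)"
    unfolding differentiable_def grad_x_eq grad_y_eq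
    using has_derivative_fst[OF 1] has_derivative_fst[OF 2] has_derivative_snd[OF 2] by blast+
  then show "((\<lambda>x'. grad_x I x' y) has_derivative hess_xx I x y) (at x)"
    and "((\<lambda>y'. grad_x I x y') has_derivative hess_xy I x y) (at y)"
    and "((\<lambda>y'. grad_y I x y') has_derivative hess_yy I x y) (at y)"
    unfolding hess_xx_def hess_xy_def hess_yy_def by (simp_all add: frechet_derivative_works)
qed

lemma grad_x_lipschitz_x:
  assumes "\<forall>x y. onorm (hess_xx I x y) \<le> Ixx"
  shows "norm (grad_x I x y - grad_x I x' y) \<le> Ixx * norm (x - x')"
  using assms has_derivative_hess(1)
  by (intro differentiable_bound[of UNIV "\<lambda>x. grad_x I x y"]) auto

lemma grad_x_lipschitz_y:
  assumes "\<forall>x y. onorm (hess_xy I x y) \<le> Ixy"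
  shows "norm (grad_x I x y - grad_x I x y') \<le> Ixy * norm (y - y')"
  using assms has_derivative_hess(2)
  by (intro differentiable_bound[of UNIV "\<lambda>y. grad_x I x y"]) auto

lemma grad_y_lipschitz_y:
  assumes "\<forall>x y. onorm (hess_yy I x y) \<le> Iyy"
  shows "norm (grad_y I x y - grad_y I x y') \<le> Iyy * norm (y - y')"
  using assms has_derivative_hess(3)
  by (intro differentiable_bound[of UNIV "\<lambda>y. grad_y I x y"]) auto

text \<open>The bound on \<^term>\<open>hess_xy I\<close> transfers to \<^term>\<open>grad_y I\<close> without symmetry of the second
  derivative: it bounds the mixed second difference of \<^term>\<open>I\<close>, which is symmetric in the two
  directions.\<close>

lemma grad_y_lipschitz_x:
  assumes xy: "\<forall>x y. onorm (hess_xy I x y) \<le> Ixy"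
  shows "norm (grad_y I x y - grad_y I x' y) \<le> Ixy * norm (x - x')"
proof (rule norm_GDERIV_le)
  show "GDERIV (\<lambda>y. I (x, y) - I (x', y)) y :> grad_y I x y - grad_y I x' y"
    using GDERIV_grad_y by (intro GDERIV_diff)
  fix v
  let ?\<psi> = "\<lambda>x. I (x, y + v) - I (x, y)"
  \<comment> \<open>The mean value inequality in \<open>x\<close> applies because the gradient of
    \<open>?\<psi>\<close> is an increment of \<open>grad_x\<close> in \<open>y\<close>, already
    bounded by \<open>Ixy * norm v\<close>.\<close>
  have "norm (?\<psi> x - ?\<psi> x') \<le> (Ixy * norm v) * norm (x - x')"
  proof (rule differentiable_bound[of UNIV])
    fix w :: 'a
    let ?D = "grad_x I w (y + v) - grad_x I w y"
    have "GDERIV ?\<psi> w :> ?D"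
      using GDERIV_grad_x by (intro GDERIV_diff)
    then show "(?\<psi> has_derivative (\<lambda>h. h \<bullet> ?D)) (at w)"
      by (simp add: gderiv_def)
    have "norm (h \<bullet> ?D) \<le> (Ixy * norm v) * norm h" for h
      using Cauchy_Schwarz_ineq2[of h ?D]
        mult_left_mono[OF grad_x_lipschitz_y[OF xy, of w "y + v" y] norm_ge_zero[of h]]
      by (simp add: mult_ac)
    then show "onorm (\<lambda>h. h \<bullet> ?D) \<le> Ixy * norm v"
      by (rule onorm_le)
  qed auto
  then show "\<bar>I (x, y + v) - I (x', y + v) - (I (x, y) - I (x', y))\<bar> \<le> Ixy * norm (x - x') * norm v"
    by (simp add: algebra_simps)
qed

lemma coupling_op_lipschitz:
  assumes xx: "\<forall>x y. onorm (hess_xx I x y) \<le> Ixx"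
    and xy: "\<forall>x y. onorm (hess_xy I x y) \<le> Ixy"
    and yy: "\<forall>x y. onorm (hess_yy I x y) \<le> Iyy"
  shows "(max Ixx Iyy + Ixy)-lipschitz_on UNIV (coupling_op I)"
proof (rule lipschitz_onI)
  let ?M = "max Ixx Iyy"
  \<comment> \<open>Operator norms are nonnegative, hence so are their upper bounds.\<close>
  have "0 \<le> onorm (hess_xx I 0 0)" "0 \<le> onorm (hess_xy I 0 0)"
    by (intro onorm_pos_le has_derivative_bounded_linear[OF has_derivative_hess(1)]
        has_derivative_bounded_linear[OF has_derivative_hess(2)])+
  then have nonneg: "0 \<le> ?M" "0 \<le> Ixy"
    using xx[rule_format, of 0 0] xy[rule_format, of 0 0] by linarith+
  then show "0 \<le> ?M + Ixy" by simp
  fix u v :: "'a \<times> 'b"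
  let ?a = "norm (fst u - fst v)" and ?b = "norm (snd u - snd v)"
  have "norm (grad_x I (fst u) (snd u) - grad_x I (fst v) (snd v))
      \<le> norm (grad_x I (fst u) (snd u) - grad_x I (fst v) (snd u))
        + norm (grad_x I (fst v) (snd u) - grad_x I (fst v) (snd v))"
    using norm_triangle_ineq[of "grad_x I (fst u) (snd u) - grad_x I (fst v) (snd u)"
        "grad_x I (fst v) (snd u) - grad_x I (fst v) (snd v)"] by simp
  also have "\<dots> \<le> Ixx * ?a + Ixy * ?b"
    by (intro add_mono grad_x_lipschitz_x grad_x_lipschitz_y xx xy)
  also have "\<dots> \<le> ?M * ?a + Ixy * ?b"
    by (intro add_mono mult_right_mono) auto
  finally have x: "norm (grad_x I (fst u) (snd u) - grad_x I (fst v) (snd v)) \<le> ?M * ?a + Ixy * ?b" .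
  have "norm (grad_y I (fst u) (snd u) - grad_y I (fst v) (snd v))
      \<le> norm (grad_y I (fst u) (snd u) - grad_y I (fst u) (snd v))
        + norm (grad_y I (fst u) (snd v) - grad_y I (fst v) (snd v))"
    using norm_triangle_ineq[of "grad_y I (fst u) (snd u) - grad_y I (fst u) (snd v)"
        "grad_y I (fst u) (snd v) - grad_y I (fst v) (snd v)"] by simp
  also have "\<dots> \<le> Iyy * ?b + Ixy * ?a"
    by (intro add_mono grad_y_lipschitz_x grad_y_lipschitz_y yy xy)
  also have "\<dots> \<le> ?M * ?b + Ixy * ?a"
    by (intro add_mono mult_right_mono) auto
  finally have y: "norm (grad_y I (fst u) (snd u) - grad_y I (fst v) (snd v)) \<le> ?M * ?b + Ixy * ?a" .
  have norm_uv: "norm (?a, ?b) = norm (u - v)" "norm (?b, ?a) = norm (u - v)"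
    by (simp_all add: norm_prod_def add.commute)
  have "norm (coupling_op I u - coupling_op I v)
      = sqrt ((norm (grad_x I (fst u) (snd u) - grad_x I (fst v) (snd v)))\<^sup>2
            + (norm (grad_y I (fst u) (snd u) - grad_y I (fst v) (snd v)))\<^sup>2)"
    by (simp add: coupling_op_def norm_prod_def norm_minus_commute)
  also have "\<dots> \<le> sqrt ((?M * ?a + Ixy * ?b)\<^sup>2 + (?M * ?b + Ixy * ?a)\<^sup>2)"
    using x y by (intro real_sqrt_le_mono add_mono power_mono) auto
  \<comment> \<open>The pair of row bounds is \<open>?M\<close> times \<open>(?a, ?b)\<close> plus
    \<open>Ixy\<close> times the swapped pair. Swapping preserves the norm, so the triangle
    inequality gives \<open>?M + Ixy\<close> without a further factor.\<close>
  also have "\<dots> = norm (?M *\<^sub>R (?a, ?b) + Ixy *\<^sub>R (?b, ?a))"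
    by (simp add: norm_prod_def)
  also have "\<dots> \<le> norm (?M *\<^sub>R (?a, ?b)) + norm (Ixy *\<^sub>R (?b, ?a))"
    by (rule norm_triangle_ineq)
  also have "\<dots> = (?M + Ixy) * norm (u - v)"
    using nonneg norm_uv by (simp only: norm_scaleR abs_of_nonneg distrib_right)
  finally show "dist (coupling_op I u) (coupling_op I v) \<le> (?M + Ixy) * dist u v"
    by (simp add: dist_norm)
qed

text \<open>Four tangent inequalities, two per block, at the corners \<open>u\<close> and
  \<open>v\<close> of a rectangle: on summation all values of \<open>I\<close> cancel. The minus
  sign in the second block of \<open>coupling_op\<close> turns concavity into monotonicity.\<close>

lemma coupling_op_monotone:
  assumes cx: "\<forall>y. convex_on UNIV (\<lambda>x. I (x, y))"
    and cy: "\<forall>x. concave_on UNIV (\<lambda>y. I (x, y))"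
  shows "0 \<le> (coupling_op I u - coupling_op I v) \<bullet> (u - v)"
proof -
  have x: "I (x, y) + grad_x I x y \<bullet> (x' - x) \<le> I (x', y)" for x x' y
    using strongly_convex_lower_bound[OF convex_on_strongly_convex_0 GDERIV_grad_x, of y x x'] cx
    by simp
  have y: "I (x, y') \<le> I (x, y) + grad_y I x y \<bullet> (y' - y)" for x y y'
    using strongly_convex_lower_bound[OF convex_on_strongly_convex_0 GDERIV_minus[OF GDERIV_grad_y], of x y y'] cy
    by (simp add: concave_on_def)
  show ?thesis
    using x[of "fst u" "snd u" "fst v"] x[of "fst v" "snd v" "fst u"]
      y[of "fst u" "snd v" "snd u"] y[of "fst v" "snd u" "snd v"]
    by (simp add: coupling_op_def inner_prod_def inner_diff_left inner_diff_right)
qed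

end

section \<open>Oracle noise\<close>

text \<open>\<open>N\<close> carries the available information (measurability), \<open>M\<close> the
  probability (second moment); one predicate thus tracks both when a variable is known and that it
  is square integrable.\<close>

definition L2_on :: "'w measure \<Rightarrow> 'w measure \<Rightarrow> ('w \<Rightarrow> 'z::euclidean_space) \<Rightarrow> bool" where
  "L2_on N M X \<longleftrightarrow> X \<in> borel_measurable N \<and> integrable M (\<lambda>\<omega>. (norm (X \<omega>))\<^sup>2)"

lemma L2_on_measurable: "L2_on N M X \<Longrightarrow> X \<in> borel_measurable N"
  by (simp add: L2_on_def)

lemma L2_on_integrable: "L2_on N M X \<Longrightarrow> integrable M (\<lambda>\<omega>. (norm (X \<omega>))\<^sup>2)"
  by (simp add: L2_on_def)

lemma L2_on_cong:
  assumes "L2_on N M X" "\<And>\<omega>. \<omega> \<in> space M \<Longrightarrow> Y \<omega> = X \<omega>" "space N = space M"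
  shows "L2_on N M Y"
proof -
  have "Y \<in> borel_measurable N \<longleftrightarrow> X \<in> borel_measurable N"
    using assms by (intro measurable_cong) simp
  moreover have "integrable M (\<lambda>\<omega>. (norm (Y \<omega>))\<^sup>2) \<longleftrightarrow> integrable M (\<lambda>\<omega>. (norm (X \<omega>))\<^sup>2)"
    using assms by (intro Bochner_Integration.integrable_cong) auto
  ultimately show ?thesis using assms by (simp add: L2_on_def)
qed

lemma L2_on_mono:
  assumes "L2_on N M X" "subalgebra N' N"
  shows "L2_on N' M X"
  using assms measurable_from_subalg unfolding L2_on_def by blast

lemma L2_on_scaleR: "L2_on N M X \<Longrightarrow> L2_on N M (\<lambda>\<omega>. c *\<^sub>R X \<omega>)"
  by (auto simp: L2_on_def power_mult_distrib)

lemma norm_add_sq_le: "(norm (x + y))\<^sup>2 \<le> 2 * (norm x)\<^sup>2 + 2 * (norm y)\<^sup>2"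
  for x y :: "'a::real_inner"
proof -
  have "0 \<le> (norm (x - y))\<^sup>2" by simp
  then show ?thesis
    by (simp add: power2_norm_eq_inner inner_add_left inner_add_right inner_diff_left inner_diff_right)
qed

lemma L2_on_add:
  assumes N: "subalgebra M N" and X: "L2_on N M X" and Y: "L2_on N M Y"
  shows "L2_on N M (\<lambda>\<omega>. X \<omega> + Y \<omega>)"
proof -
  have [measurable]: "X \<in> borel_measurable M" "Y \<in> borel_measurable M"
    using X Y measurable_from_subalg[OF N] by (auto simp: L2_on_def)
  have "integrable M (\<lambda>\<omega>. (norm (X \<omega> + Y \<omega>))\<^sup>2)"
    by (rule Bochner_Integration.integrable_bound[of _ "\<lambda>\<omega>. 2 * (norm (X \<omega>))\<^sup>2 + 2 * (norm (Y \<omega>))\<^sup>2"])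
      (use X Y norm_add_sq_le in \<open>auto simp: L2_on_def\<close>)
  then show ?thesis using X Y by (auto simp: L2_on_def)
qed

lemma L2_on_diff:
  assumes N: "subalgebra M N" and X: "L2_on N M X" and Y: "L2_on N M Y"
  shows "L2_on N M (\<lambda>\<omega>. X \<omega> - Y \<omega>)"
  using L2_on_add[OF N X L2_on_scaleR[OF Y, of "-1"]] by simp

lemma L2_on_const: "finite_measure M \<Longrightarrow> L2_on N M (\<lambda>\<omega>. c)"
  by (auto simp: L2_on_def finite_measure.integrable_const)

text \<open>A Lipschitz map grows at most linearly away from \<open>G 0\<close>, and the constant
  \<open>G 0\<close> is square integrable over a finite measure.\<close>

lemma L2_on_lipschitz:
  fixes G :: "'z::euclidean_space \<Rightarrow> 'z"
  assumes fin: "finite_measure M" and N: "subalgebra M N" and X: "L2_on N M X"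
    and G: "c-lipschitz_on UNIV G"
  shows "L2_on N M (\<lambda>\<omega>. G (X \<omega>))"
proof -
  have G_meas [measurable]: "G \<in> borel_measurable borel"
    using lipschitz_on_continuous_on[OF G] by (rule borel_measurable_continuous_onI)
  have [measurable]: "X \<in> borel_measurable N" "X \<in> borel_measurable M"
    using X measurable_from_subalg[OF N] by (auto simp: L2_on_def)
  have bound: "norm (G x - G 0) \<le> c * norm x" for x
    using lipschitz_onD[OF G, of x 0] by (simp add: dist_norm)
  have "integrable M (\<lambda>\<omega>. (norm (G (X \<omega>) - G 0))\<^sup>2)"
  proof (rule Bochner_Integration.integrable_bound[of _ "\<lambda>\<omega>. c\<^sup>2 * (norm (X \<omega>))\<^sup>2"])
    show "AE \<omega> in M. norm ((norm (G (X \<omega>) - G 0))\<^sup>2) \<le> norm (c\<^sup>2 * (norm (X \<omega>))\<^sup>2)"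
      using power_mono[OF bound norm_ge_zero, of _ 2] by (simp add: power_mult_distrib)
  qed (use X in \<open>auto simp: L2_on_def\<close>)
  then have "L2_on N M (\<lambda>\<omega>. G (X \<omega>) - G 0)"
    by (simp add: L2_on_def)
  from L2_on_add[OF N this L2_on_const[OF fin, of N "G 0"]] show ?thesis by simp
qed

lemma L2_on_inner:
  fixes X Y :: "'a \<Rightarrow> 'b::euclidean_space"
  assumes N: "subalgebra M N" and X: "L2_on N M X" and Y: "L2_on N M Y"
  shows "integrable M (\<lambda>\<omega>. X \<omega> \<bullet> Y \<omega>)"
proof -
  have [measurable]: "X \<in> borel_measurable M" "Y \<in> borel_measurable M"
    using X Y measurable_from_subalg[OF N] by (auto simp: L2_on_def)
  have "\<bar>x \<bullet> y\<bar> \<le> (norm x)\<^sup>2 + (norm y)\<^sup>2" for x y :: 'b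
    using Cauchy_Schwarz_ineq2[of x y] sum_squares_bound[of "norm x" "norm y"]
      mult_nonneg_nonneg[OF norm_ge_zero[of x] norm_ge_zero[of y]]
    by linarith
  then have le: "norm (X \<omega> \<bullet> Y \<omega>) \<le> norm ((norm (X \<omega>))\<^sup>2 + (norm (Y \<omega>))\<^sup>2)" for \<omega>
    by simp
  show ?thesis
  proof (rule Bochner_Integration.integrable_bound)
    show "integrable M (\<lambda>\<omega>. (norm (X \<omega>))\<^sup>2 + (norm (Y \<omega>))\<^sup>2)"
      using X Y by (intro Bochner_Integration.integrable_add L2_on_integrable)
  qed (use le in simp_all)
qed

section \<open>A fresh oracle sample queried at a point known from an independent past\<close>

context prob_space
begin

context
  fixes N :: "'a measure" and S :: "'s measure" and s :: "'a \<Rightarrow> 's"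
    and Gt :: "'z::euclidean_space \<Rightarrow> 's \<Rightarrow> 'z" and G :: "'z \<Rightarrow> 'z" and \<sigma> :: real
    and P :: "'a \<Rightarrow> 'z"
  assumes orc: "unbiased_oracle M S s Gt G \<sigma>"
    and G [measurable]: "G \<in> borel_measurable borel"
    and N: "subalgebra M N"
    and indep: "\<And>A B. A \<in> sets N \<Longrightarrow> B \<in> sets S \<Longrightarrow>
      prob (A \<inter> (s -` B \<inter> space M)) = prob A * prob (s -` B \<inter> space M)"
    and P [measurable]: "P \<in> borel_measurable N"
begin

lemma oracle_measurable:
  "s \<in> M \<rightarrow>\<^sub>M S" "(\<lambda>(z, a). Gt z a) \<in> borel \<Otimes>\<^sub>M S \<rightarrow>\<^sub>M borel"
  using orc by (auto simp: unbiased_oracle_def)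

lemma oracle_moments:
  "integrable M (\<lambda>\<omega>. Gt p (s \<omega>))"
  "(\<integral>\<omega>. Gt p (s \<omega>) \<partial>M) = G p"
  "integrable M (\<lambda>\<omega>. (norm (Gt p (s \<omega>) - G p))\<^sup>2)"
  "(\<integral>\<omega>. (norm (Gt p (s \<omega>) - G p))\<^sup>2 \<partial>M) \<le> \<sigma>\<^sup>2"
  using orc unfolding unbiased_oracle_def by blast+

lemma measurable_ident_subalg: "(\<lambda>\<omega>. \<omega>) \<in> M \<rightarrow>\<^sub>M N"
  using measurable_from_subalg[OF N measurable_ident] by (simp add: id_def)

lemma measurable_Pair_source: "(\<lambda>\<omega>. (\<omega>, s \<omega>)) \<in> M \<rightarrow>\<^sub>M N \<Otimes>\<^sub>M S"
  by (intro measurable_Pair measurable_ident_subalg oracle_measurable)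

lemma prob_space_marginals:
  "prob_space (distr M N (\<lambda>\<omega>. \<omega>))" "prob_space (distr M S s)"
  by (intro prob_space_distr measurable_ident_subalg oracle_measurable)+

text \<open>Independence as a product law, checked on rectangles, so that Tonelli and Fubini can
  replace conditional expectations. The first coordinate is the whole outcome seen through
  \<open>N\<close>, so any \<open>N\<close>-measurable query or test vector can be frozen together
  with it.\<close>

lemma oracle_distr:
  "distr M N (\<lambda>\<omega>. \<omega>) \<Otimes>\<^sub>M distr M S s = distr M (N \<Otimes>\<^sub>M S) (\<lambda>\<omega>. (\<omega>, s \<omega>))"
proof (rule pair_measure_eqI)
  show "sigma_finite_measure (distr M N (\<lambda>\<omega>. \<omega>))" "sigma_finite_measure (distr M S s)"
    by (intro prob_space_imp_sigma_finite prob_space_marginals)+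
  fix A B assume "A \<in> sets (distr M N (\<lambda>\<omega>. \<omega>))" "B \<in> sets (distr M S s)"
  then have A: "A \<in> sets N" and B: "B \<in> sets S" by simp_all
  have "A \<subseteq> space M" using A N sets.sets_into_space by (fastforce simp: subalgebra_def)
  have AM: "A \<inter> space M = A" using \<open>A \<subseteq> space M\<close> by auto
  then have eq: "(\<lambda>\<omega>. (\<omega>, s \<omega>)) -` (A \<times> B) \<inter> space M = A \<inter> (s -` B \<inter> space M)"
    and eqA: "(\<lambda>\<omega>. \<omega>) -` A \<inter> space M = A" by auto
  show "emeasure (distr M N (\<lambda>\<omega>. \<omega>)) A * emeasure (distr M S s) B
      = emeasure (distr M (N \<Otimes>\<^sub>M S) (\<lambda>\<omega>. (\<omega>, s \<omega>))) (A \<times> B)"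
    using A B indep[OF A B]
    by (simp add: emeasure_distr measurable_ident_subalg oracle_measurable(1) measurable_Pair_source eq AM
        emeasure_eq_measure ennreal_mult)
qed simp

text \<open>Tonelli: with the past frozen, the inner integral is the oracle variance at one fixed
  query point, bounded by the oracle assumption.\<close>

lemma oracle_noise_sq:
  shows "integrable M (\<lambda>\<omega>. (norm (Gt (P \<omega>) (s \<omega>) - G (P \<omega>)))\<^sup>2)"
    and "(\<integral>\<omega>. (norm (Gt (P \<omega>) (s \<omega>) - G (P \<omega>)))\<^sup>2 \<partial>M) \<le> \<sigma>\<^sup>2"
proof -
  let ?q = "\<lambda>(\<omega>, a). (norm (Gt (P \<omega>) a - G (P \<omega>)))\<^sup>2"
  note oracle_measurable [measurable]
  have q: "?q \<in> borel_measurable (N \<Otimes>\<^sub>M S)" by measurable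
  then have qe: "(\<lambda>p. ennreal (?q p)) \<in> borel_measurable (N \<Otimes>\<^sub>M S)"
    by (rule measurable_compose[OF _ measurable_ennreal])
  interpret \<Lambda>: prob_space "distr M N (\<lambda>\<omega>. \<omega>)" by (rule prob_space_marginals)
  interpret \<rho>: prob_space "distr M S s" by (rule prob_space_marginals)
  have "(\<integral>\<^sup>+ \<omega>. ?q (\<omega>, s \<omega>) \<partial>M) = (\<integral>\<^sup>+ p. ?q p \<partial>(distr M N (\<lambda>\<omega>. \<omega>) \<Otimes>\<^sub>M distr M S s))"
    using qe unfolding oracle_distr
    by (subst nn_integral_distr[OF measurable_Pair_source]) (simp_all only: measurable_distr_eq1)
  also have "\<dots> = (\<integral>\<^sup>+ x. \<integral>\<^sup>+ a. ?q (x, a) \<partial>distr M S s \<partial>distr M N (\<lambda>\<omega>. \<omega>))"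
    by (intro \<rho>.nn_integral_fst[symmetric]) (simp only: oracle_distr measurable_distr_eq1 qe)
  also have "\<dots> \<le> (\<integral>\<^sup>+ x. ennreal (\<sigma>\<^sup>2) \<partial>distr M N (\<lambda>\<omega>. \<omega>))"
  proof (rule nn_integral_mono)
    fix x assume "x \<in> space (distr M N (\<lambda>\<omega>. \<omega>))"
    then have x: "x \<in> space N" by simp
    have "(\<integral>\<^sup>+ a. ?q (x, a) \<partial>distr M S s) = (\<integral>\<^sup>+ \<omega>. ?q (x, s \<omega>) \<partial>M)"
      using measurable_compose[OF measurable_Pair1'[OF x] qe]
      by (subst nn_integral_distr[OF oracle_measurable(1)]) (simp_all only: measurable_distr_eq1)
    also have "\<dots> = ennreal (\<integral>\<omega>. ?q (x, s \<omega>) \<partial>M)"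
      using oracle_moments(3)[of "P x"] by (intro nn_integral_eq_integral) simp_all
    also have "\<dots> \<le> ennreal (\<sigma>\<^sup>2)"
      using oracle_moments(4)[of "P x"] by (intro ennreal_leI) simp
    finally show "(\<integral>\<^sup>+ a. ?q (x, a) \<partial>distr M S s) \<le> ennreal (\<sigma>\<^sup>2)" .
  qed
  also have "\<dots> = ennreal (\<sigma>\<^sup>2)"
    using \<Lambda>.emeasure_space_1 by simp
  finally have le: "(\<integral>\<^sup>+ \<omega>. (norm (Gt (P \<omega>) (s \<omega>) - G (P \<omega>)))\<^sup>2 \<partial>M) \<le> ennreal (\<sigma>\<^sup>2)"
    unfolding prod.case .
  have meas: "(\<lambda>\<omega>. (norm (Gt (P \<omega>) (s \<omega>) - G (P \<omega>)))\<^sup>2) \<in> borel_measurable M"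
    using measurable_compose[OF measurable_Pair_source q] unfolding prod.case .
  \<comment> \<open>The finite nonnegative integral just bounded yields integrability, so only
    measurability had to be known beforehand.\<close>
  show int: "integrable M (\<lambda>\<omega>. (norm (Gt (P \<omega>) (s \<omega>) - G (P \<omega>)))\<^sup>2)"
    by (rule integrableI_nonneg[OF meas _ order.strict_trans1[OF le ennreal_less_top, folded infinity_ennreal_def]])
      (intro AE_I2 zero_le_power2)
  show "(\<integral>\<omega>. (norm (Gt (P \<omega>) (s \<omega>) - G (P \<omega>)))\<^sup>2 \<partial>M) \<le> \<sigma>\<^sup>2"
    using le nn_integral_eq_integral[OF int AE_I2[OF zero_le_power2]]
    by (simp only: ennreal_le_iff zero_le_power2)
qed

text \<open>Fubini: with the past frozen, \<open>U\<close> is constant and unbiasedness makes the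
  inner integral vanish.\<close>

lemma oracle_noise_inner:
  assumes U: "L2_on N M U"
  shows "integrable M (\<lambda>\<omega>. (Gt (P \<omega>) (s \<omega>) - G (P \<omega>)) \<bullet> U \<omega>)"
    and "(\<integral>\<omega>. (Gt (P \<omega>) (s \<omega>) - G (P \<omega>)) \<bullet> U \<omega> \<partial>M) = 0"
proof -
  let ?h = "\<lambda>(\<omega>, a). (Gt (P \<omega>) a - G (P \<omega>)) \<bullet> U \<omega>"
  note oracle_measurable [measurable]
  have U_meas [measurable]: "U \<in> borel_measurable N" using U by (rule L2_on_measurable)
  have h: "?h \<in> borel_measurable (N \<Otimes>\<^sub>M S)" by measurable
  have noise: "(\<lambda>(\<omega>, a). Gt (P \<omega>) a - G (P \<omega>)) \<in> borel_measurable (N \<Otimes>\<^sub>M S)"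
    by measurable
  have noise_meas: "(\<lambda>\<omega>. Gt (P \<omega>) (s \<omega>) - G (P \<omega>)) \<in> borel_measurable M"
    using measurable_compose[OF measurable_Pair_source noise] unfolding prod.case .
  \<comment> \<open>Fubini requires integrability of the product, which follows from square
    integrability of both factors.\<close>
  have "L2_on M M (\<lambda>\<omega>. Gt (P \<omega>) (s \<omega>) - G (P \<omega>))"
    using noise_meas oracle_noise_sq(1) unfolding L2_on_def by blast
  then show int: "integrable M (\<lambda>\<omega>. (Gt (P \<omega>) (s \<omega>) - G (P \<omega>)) \<bullet> U \<omega>)"
    using L2_on_mono[OF U N] by (intro L2_on_inner[of M M]) (auto simp: subalgebra_def)
  interpret \<Lambda>: prob_space "distr M N (\<lambda>\<omega>. \<omega>)" by (rule prob_space_marginals)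
  interpret \<rho>: prob_space "distr M S s" by (rule prob_space_marginals)
  interpret pair_sigma_finite "distr M N (\<lambda>\<omega>. \<omega>)" "distr M S s" ..
  have int': "integrable (distr M N (\<lambda>\<omega>. \<omega>) \<Otimes>\<^sub>M distr M S s) ?h"
    using int by (simp only: oracle_distr integrable_distr_eq[OF measurable_Pair_source h] prod.case)
  have "(\<integral>\<omega>. (Gt (P \<omega>) (s \<omega>) - G (P \<omega>)) \<bullet> U \<omega> \<partial>M)
      = (\<integral>p. ?h p \<partial>(distr M N (\<lambda>\<omega>. \<omega>) \<Otimes>\<^sub>M distr M S s))"
    by (simp only: oracle_distr integral_distr[OF measurable_Pair_source h] prod.case)
  also have "\<dots> = (\<integral>x. \<integral>a. ?h (x, a) \<partial>distr M S s \<partial>distr M N (\<lambda>\<omega>. \<omega>))"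
    by (rule integral_fst'[OF int', symmetric])
  also have "\<dots> = (\<integral>x. 0 \<partial>distr M N (\<lambda>\<omega>. \<omega>))"
  proof (rule Bochner_Integration.integral_cong[OF refl])
    fix x assume "x \<in> space (distr M N (\<lambda>\<omega>. \<omega>))"
    then have x: "x \<in> space N" by simp
    have "(\<integral>a. ?h (x, a) \<partial>distr M S s) = (\<integral>\<omega>. ?h (x, s \<omega>) \<partial>M)"
      by (intro integral_distr oracle_measurable measurable_compose[OF measurable_Pair1'[OF x] h])
    also have "\<dots> = (\<integral>\<omega>. Gt (P x) (s \<omega>) - G (P x) \<partial>M) \<bullet> U x"
      using oracle_moments(1)[of "P x"] by simp
    also have "\<dots> = 0"
      using oracle_moments(1,2)[of "P x"] by (simp add: prob_space)
    finally show "(\<integral>a. ?h (x, a) \<partial>distr M S s) = 0" .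
  qed
  finally show "(\<integral>\<omega>. (Gt (P \<omega>) (s \<omega>) - G (P \<omega>)) \<bullet> U \<omega> \<partial>M) = 0"
    by simp
qed

text \<open>The sample is noise plus \<open>G\<close> at the query, both square integrable;
  \<open>N'\<close> is the past enlarged so as to contain the sample's noise variable.\<close>

lemma L2_on_oracle:
  assumes G_lip: "c-lipschitz_on UNIV G" and PL2: "L2_on N M P"
    and N': "subalgebra N' N" "subalgebra M N'" and s: "s \<in> N' \<rightarrow>\<^sub>M S"
  shows "L2_on N' M (\<lambda>\<omega>. Gt (P \<omega>) (s \<omega>))"
proof -
  have P': "P \<in> borel_measurable N'"
    using P N'(1) by (rule measurable_from_subalg[rotated])
  have "(\<lambda>\<omega>. (P \<omega>, s \<omega>)) \<in> N' \<rightarrow>\<^sub>M borel \<Otimes>\<^sub>M S"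
    using P' s by (rule measurable_Pair)
  from measurable_compose[OF this oracle_measurable(2)]
  have "(\<lambda>\<omega>. Gt (P \<omega>) (s \<omega>)) \<in> borel_measurable N'"
    unfolding prod.case .
  then have "(\<lambda>\<omega>. Gt (P \<omega>) (s \<omega>) - G (P \<omega>)) \<in> borel_measurable N'"
    using measurable_compose[OF P' G] by (rule borel_measurable_diff)
  then have noise: "L2_on N' M (\<lambda>\<omega>. Gt (P \<omega>) (s \<omega>) - G (P \<omega>))"
    using oracle_noise_sq(1) unfolding L2_on_def by blast
  have "L2_on N' M (\<lambda>\<omega>. G (P \<omega>))"
    by (rule L2_on_mono[OF L2_on_lipschitz[OF finite_measure_axioms N PL2 G_lip] N'(1)])
  from L2_on_add[OF N'(2) noise this] show ?thesis by simp
qed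

end

end

section \<open>Independent sources\<close>

definition source_sets where
  "source_sets M z0 S \<zeta> T \<xi> i = (case i of
      Init \<Rightarrow> {z0 -` A \<inter> space M |A. A \<in> sets borel}
    | OpNoise k \<Rightarrow> {\<zeta> k -` A \<inter> space M |A. A \<in> sets S}
    | GradNoise k \<Rightarrow> {\<xi> k -` A \<inter> space M |A. A \<in> sets T})"

lemma source_sets_simps:
  "source_sets M z0 S \<zeta> T \<xi> Init = {z0 -` A \<inter> space M |A. A \<in> sets borel}"
  "source_sets M z0 S \<zeta> T \<xi> (OpNoise k) = {\<zeta> k -` A \<inter> space M |A. A \<in> sets S}"
  "source_sets M z0 S \<zeta> T \<xi> (GradNoise k) = {\<xi> k -` A \<inter> space M |A. A \<in> sets T}"
  unfolding source_sets_def source.case by (rule refl)+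

text \<open>Independence passes from generators to the generated sigma-algebras when the generators
  are stable under intersection.\<close>

lemma Int_stable_preimages: "Int_stable {X -` A \<inter> space M |A. A \<in> sets N}"
proof (rule Int_stableI)
  fix a b assume "a \<in> {X -` A \<inter> space M |A. A \<in> sets N}" "b \<in> {X -` A \<inter> space M |A. A \<in> sets N}"
  then obtain A B where "a = X -` A \<inter> space M" "b = X -` B \<inter> space M" "A \<in> sets N" "B \<in> sets N"
    by auto
  then show "a \<inter> b \<in> {X -` A \<inter> space M |A. A \<in> sets N}"
    by (intro CollectI exI[of _ "A \<inter> B"]) auto
qed

locale noise_sources = prob_space M
  for M :: "'w measure" +
  fixes z0 :: "'w \<Rightarrow> 'z::topological_space"
    and S :: "'s measure" and \<zeta> :: "nat \<Rightarrow> 'w \<Rightarrow> 's" and T :: "'t measure" and \<xi> :: "nat \<Rightarrow> 'w \<Rightarrow> 't"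
  assumes indep_sources: "indep_sources M z0 S \<zeta> T \<xi>"
begin

abbreviation E where "E \<equiv> source_sets M z0 S \<zeta> T \<xi>"

lemma indep_E: "indep_sets E UNIV"
  using indep_sources unfolding indep_sources_def source_sets_def by blast

lemma E_subset: "E i \<subseteq> sets M"
  using indep_E unfolding indep_sets_def by auto

text \<open>Indexed by sets of sources rather than by time, because two noise families are revealed
  alternately.\<close>

definition past :: "source set \<Rightarrow> 'w measure" where
  "past J = sigma (space M) (\<Union>i\<in>J. E i)"

lemma E_subset_Pow: "(\<Union>i\<in>J. E i) \<subseteq> Pow (space M)"
  using E_subset sets.sets_into_space by blast

lemma space_past [simp]: "space (past J) = space M"
  and sets_past: "sets (past J) = sigma_sets (space M) (\<Union>i\<in>J. E i)"
  unfolding past_def using E_subset_Pow by (simp_all add: space_measure_of sets_measure_of)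

lemma subalgebra_past: "subalgebra M (past J)"
proof -
  have "(\<Union>i\<in>J. E i) \<subseteq> sets M" using E_subset by blast
  then show ?thesis
    unfolding subalgebra_def sets_past by (simp only: space_past sets.sigma_sets_subset simp_thms)
qed

lemma subalgebra_past_mono: "J \<subseteq> J' \<Longrightarrow> subalgebra (past J') (past J)"
  unfolding subalgebra_def sets_past space_past
  by (intro conjI refl sigma_sets_mono' UN_mono order_refl)

lemma source_measurable:
  assumes "i \<in> J" "X \<in> space M \<rightarrow> space N" "E i = {X -` A \<inter> space M |A. A \<in> sets N}"
  shows "X \<in> past J \<rightarrow>\<^sub>M N"
proof (rule measurableI)
  fix A assume "A \<in> sets N"
  then have "X -` A \<inter> space M \<in> (\<Union>i\<in>J. E i)" using assms(1,3) by blast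
  then show "X -` A \<inter> space (past J) \<in> sets (past J)"
    unfolding sets_past space_past by (rule sigma_sets.Basic)
qed (use assms(2) space_past in blast)

lemma past_measurable:
  shows "Init \<in> J \<Longrightarrow> z0 \<in> past J \<rightarrow>\<^sub>M borel"
    and "OpNoise k \<in> J \<Longrightarrow> \<zeta> k \<in> past J \<rightarrow>\<^sub>M S"
    and "GradNoise k \<in> J \<Longrightarrow> \<xi> k \<in> past J \<rightarrow>\<^sub>M T"
proof -
  have sources: "z0 \<in> M \<rightarrow>\<^sub>M borel" "\<zeta> k \<in> M \<rightarrow>\<^sub>M S" "\<xi> k \<in> M \<rightarrow>\<^sub>M T"
    using indep_sources unfolding indep_sources_def by blast+
  show "z0 \<in> past J \<rightarrow>\<^sub>M borel" if "Init \<in> J"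
    using that sources(1)[THEN measurable_space]
    by (intro source_measurable[OF _ _ source_sets_simps(1)] Pi_I)
  show "\<zeta> k \<in> past J \<rightarrow>\<^sub>M S" if "OpNoise k \<in> J"
    using that sources(2)[THEN measurable_space]
    by (intro source_measurable[OF _ _ source_sets_simps(2)] Pi_I)
  show "\<xi> k \<in> past J \<rightarrow>\<^sub>M T" if "GradNoise k \<in> J"
    using that sources(3)[THEN measurable_space]
    by (intro source_measurable[OF _ _ source_sets_simps(3)] Pi_I)
qed

text \<open>The sources are grouped into the two disjoint blocks \<open>J\<close> and
  \<open>{i}\<close>; sigma-algebras generated by disjoint blocks of an independent family are
  independent.\<close>

lemma past_indep:
  assumes "i \<notin> J" "A \<in> sets (past J)" "B \<in> E i"
  shows "prob (A \<inter> B) = prob A * prob B"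
proof -
  let ?I = "\<lambda>b. if b then J else {i}"
  have "indep_sets (\<lambda>b. sigma_sets (space M) (\<Union>j\<in>?I b. E j)) UNIV"
  proof (rule indep_sets_collect_sigma)
    show "indep_sets E (\<Union>b\<in>UNIV. ?I b)"
      by (rule indep_sets_mono_index[OF _ indep_E]) simp
    show "Int_stable (E j)" for j
      by (cases j; hypsubst; unfold source_sets_simps; rule Int_stable_preimages)
    show "disjoint_family_on ?I UNIV"
      using assms(1) by (auto simp: disjoint_family_on_def)
  qed
  \<comment> \<open>Independence of two set systems is defined through a \<open>case_bool\<close>
    family, hence the Boolean index.\<close>
  moreover have "(\<lambda>b. sigma_sets (space M) (\<Union>j\<in>?I b. E j))
      = case_bool (sigma_sets (space M) (\<Union>j\<in>J. E j)) (sigma_sets (space M) (E i))"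
    by (auto simp: fun_eq_iff split: bool.split)
  ultimately have "indep_set (sigma_sets (space M) (\<Union>j\<in>J. E j)) (sigma_sets (space M) (E i))"
    unfolding indep_set_def by (simp only:)
  then show ?thesis
    using assms(2)[unfolded sets_past] sigma_sets.Basic[OF assms(3)] by (rule indep_setD)
qed

lemma past_indep_OpNoise:
  assumes "OpNoise k \<notin> J" "A \<in> sets (past J)" "B \<in> sets S"
  shows "prob (A \<inter> (\<zeta> k -` B \<inter> space M)) = prob A * prob (\<zeta> k -` B \<inter> space M)"
  using assms(1,2) by (rule past_indep) (unfold source_sets_simps, intro CollectI exI conjI, rule refl, rule assms(3))

lemma past_indep_GradNoise:
  assumes "GradNoise k \<notin> J" "A \<in> sets (past J)" "B \<in> sets T"
  shows "prob (A \<inter> (\<xi> k -` B \<inter> space M)) = prob A * prob (\<xi> k -` B \<inter> space M)"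
  using assms(1,2) by (rule past_indep) (unfold source_sets_simps, intro CollectI exI conjI, rule refl, rule assms(3))

end

section \<open>The AG-OG recursion in expectation\<close>

text \<open>Purely pathwise: \<open>g\<close>, \<open>Hp\<close> and \<open>Hh\<close> are arbitrary
  vectors, so samples can be inserted and their errors survive only as the two final inner
  products.\<close>

lemma ag_og_step:
  fixes F :: "'z::euclidean_space \<Rightarrow> real" and w z Hp Hh g zs :: 'z and \<eta> L \<mu> :: real and k :: nat
    and H :: "'z \<Rightarrow> 'z"
  defines "\<alpha> \<equiv> 2 / (real k + 2)"
  defines "Q \<equiv> \<lambda>w. F w - F zs + H zs \<bullet> (w - zs)"
  assumes sc: "strongly_convex \<mu> F" and \<mu>: "0 \<le> \<mu>" and sm: "smooth_fun L F"
    and mono: "\<And>u v. 0 \<le> (H u - H v) \<bullet> (u - v)"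
    and \<eta>: "0 \<le> \<eta>"
    and m: "m = (1 - \<alpha>) *\<^sub>R w + \<alpha> *\<^sub>R z"
    and h: "h = z - \<eta> *\<^sub>R (Hp + g)"
    and w': "w' = (1 - \<alpha>) *\<^sub>R w + \<alpha> *\<^sub>R h"
    and z': "z' = z - \<eta> *\<^sub>R (Hh + g)"
  shows "(real k + 2) * \<eta> * Q w' + (norm (z' - zs))\<^sup>2
    \<le> real k * \<eta> * Q w + (norm (z - zs))\<^sup>2 + \<eta>\<^sup>2 * (norm (Hh - Hp))\<^sup>2
      - (1 - 2 * L * \<eta> / (real k + 2)) * (norm (h - z))\<^sup>2
      - 2 * \<eta> * ((g - grad F m) \<bullet> (h - zs)) - 2 * \<eta> * ((Hh - H h) \<bullet> (h - zs))"
proof -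
  \<comment> \<open>The last two identities turn the averaging weights into the factors
    \<open>k\<close> and \<open>k + 2\<close> of the potential.\<close>
  have \<alpha>: "0 < \<alpha>" "\<alpha> \<le> 1" "(real k + 2) * \<alpha> = 2" "(real k + 2) * (1 - \<alpha>) = real k"
    by (simp_all add: \<alpha>_def field_simps)
  have G: "GDERIV F m :> grad F m"
    using sm by (auto simp: smooth_fun_def intro: GDERIV_grad)
  have lower: "F m + grad F m \<bullet> (u - m) \<le> F u" for u
    using strongly_convex_lower_bound[OF sc G, of u] mult_nonneg_nonneg[OF divide_nonneg_nonneg[OF \<mu>, of 2] zero_le_power2[of "norm (u - m)"]]
    by simp
  \<comment> \<open>The first form feeds the quadratic term of the descent lemma; the second splits
    the linear term so that convexity applies at \<open>w\<close> and \<open>zs\<close> and only the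
    half step remains.\<close>
  have w'm: "w' - m = \<alpha> *\<^sub>R (h - z)" "w' - m = (1 - \<alpha>) *\<^sub>R (w - m) + \<alpha> *\<^sub>R (zs - m) + \<alpha> *\<^sub>R (h - zs)"
    by (simp_all add: w' m algebra_simps)
  have "F w' \<le> F m + grad F m \<bullet> (w' - m) + L / 2 * (norm (w' - m))\<^sup>2"
    by (rule descent_lemma[OF sm])
  also have "L / 2 * (norm (w' - m))\<^sup>2 = L / 2 * \<alpha>\<^sup>2 * (norm (h - z))\<^sup>2"
    by (simp add: w'm(1) power_mult_distrib)
  also have "F m + grad F m \<bullet> (w' - m) = (1 - \<alpha>) * (F m + grad F m \<bullet> (w - m))
      + \<alpha> * (F m + grad F m \<bullet> (zs - m)) + \<alpha> * (grad F m \<bullet> (h - zs))"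
    unfolding w'm(2) by (simp add: inner_add_right algebra_simps)
  also have "\<dots> \<le> (1 - \<alpha>) * F w + \<alpha> * F zs + \<alpha> * (grad F m \<bullet> (h - zs))"
    using \<alpha> by (intro add_mono mult_left_mono lower) auto
  finally have Fw': "F w' \<le> (1 - \<alpha>) * F w + \<alpha> * F zs + \<alpha> * (grad F m \<bullet> (h - zs))
      + L / 2 * \<alpha>\<^sup>2 * (norm (h - z))\<^sup>2" by simp
  \<comment> \<open>The linear part of \<open>Q\<close> averages exactly; monotonicity then replaces
    \<open>H zs\<close> by \<open>H h\<close> at the half step.\<close>
  have "w' - zs = (1 - \<alpha>) *\<^sub>R (w - zs) + \<alpha> *\<^sub>R (h - zs)"
    by (simp add: w' algebra_simps)
  then have "H zs \<bullet> (w' - zs) = (1 - \<alpha>) * (H zs \<bullet> (w - zs)) + \<alpha> * (H zs \<bullet> (h - zs))"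
    by (simp add: inner_add_right)
  also have "\<dots> \<le> (1 - \<alpha>) * (H zs \<bullet> (w - zs)) + \<alpha> * (H h \<bullet> (h - zs))"
    using \<alpha> mono[of h zs] by (intro add_left_mono mult_left_mono) (auto simp: inner_diff_left)
  finally have "Q w' \<le> (1 - \<alpha>) * Q w + \<alpha> * ((grad F m + H h) \<bullet> (h - zs)) + L / 2 * \<alpha>\<^sup>2 * (norm (h - z))\<^sup>2"
    using Fw' unfolding Q_def by (simp add: inner_add_left algebra_simps)
  then have "((real k + 2) * \<eta>) * Q w' \<le> ((real k + 2) * \<eta>) * ((1 - \<alpha>) * Q w
      + \<alpha> * ((grad F m + H h) \<bullet> (h - zs)) + L / 2 * \<alpha>\<^sup>2 * (norm (h - z))\<^sup>2)"
    using \<eta> by (intro mult_left_mono) auto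
  also have "\<dots> = \<eta> * ((real k + 2) * (1 - \<alpha>)) * Q w
      + \<eta> * ((real k + 2) * \<alpha>) * ((grad F m + H h) \<bullet> (h - zs))
      + \<eta> * L / 2 * ((real k + 2) * \<alpha>) * \<alpha> * (norm (h - z))\<^sup>2"
    by (simp add: algebra_simps power2_eq_square)
  also have "\<dots> = real k * \<eta> * Q w + 2 * \<eta> * ((grad F m + H h) \<bullet> (h - zs))
      + \<eta> * L * \<alpha> * (norm (h - z))\<^sup>2"
    unfolding \<alpha>(3,4) by simp
  finally have Qw': "(real k + 2) * \<eta> * Q w' \<le> real k * \<eta> * Q w
      + 2 * \<eta> * ((grad F m + H h) \<bullet> (h - zs)) + 2 * L * \<eta> / (real k + 2) * (norm (h - z))\<^sup>2"
    by (simp add: \<alpha>_def mult_ac)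
  \<comment> \<open>Four-point identity, without loss. Both updates use the same \<open>g\<close>,
    so \<open>h - z'\<close> involves only the two operator samples.\<close>
  have "2 * ((z - z') \<bullet> (h - zs)) = (norm (z - zs))\<^sup>2 - (norm (z' - zs))\<^sup>2 + (norm (h - z'))\<^sup>2 - (norm (h - z))\<^sup>2"
    by (simp add: power2_norm_eq_inner inner_diff_left inner_diff_right inner_commute)
  moreover have "z - z' = \<eta> *\<^sub>R (Hh + g)" "h - z' = \<eta> *\<^sub>R (Hh - Hp)"
    by (simp_all add: z' h algebra_simps)
  ultimately have "2 * \<eta> * ((Hh + g) \<bullet> (h - zs))
      = (norm (z - zs))\<^sup>2 - (norm (z' - zs))\<^sup>2 + \<eta>\<^sup>2 * (norm (Hh - Hp))\<^sup>2 - (norm (h - z))\<^sup>2"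
    by (simp add: power_mult_distrib)
  moreover have "2 * \<eta> * ((grad F m + H h) \<bullet> (h - zs)) = 2 * \<eta> * ((Hh + g) \<bullet> (h - zs))
      - 2 * \<eta> * ((g - grad F m) \<bullet> (h - zs)) - 2 * \<eta> * ((Hh - H h) \<bullet> (h - zs))"
    by (simp add: inner_add_left inner_diff_left algebra_simps)
  ultimately show ?thesis
    using Qw' by (simp add: left_diff_distrib)
qed

text \<open>The step sizes enter only through nonnegativity and three inequalities, to be verified
  later for the explicit formula.\<close>

locale stochastic_ag_og = noise_sources M "z 0" S \<zeta> T \<xi>
  for M :: "'w measure" and z :: "nat \<Rightarrow> 'w \<Rightarrow> 'z::euclidean_space"
    and S :: "'s measure" and \<zeta> :: "nat \<Rightarrow> 'w \<Rightarrow> 's" and T :: "'t measure" and \<xi> :: "nat \<Rightarrow> 'w \<Rightarrow> 't" +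
  fixes F :: "'z \<Rightarrow> real" and H :: "'z \<Rightarrow> 'z" and \<mu> L LH \<sigma>H \<sigma>F :: real
    and Ht :: "'z \<Rightarrow> 's \<Rightarrow> 'z" and Ft :: "'z \<Rightarrow> 't \<Rightarrow> 'z"
    and K :: nat and \<eta> :: "nat \<Rightarrow> real" and zh zag zmd :: "nat \<Rightarrow> 'w \<Rightarrow> 'z" and zstar :: 'z
  assumes \<mu>_pos: "0 < \<mu>" and F_convex: "strongly_convex \<mu> F" and F_smooth: "smooth_fun L F"
    and H_lipschitz: "LH-lipschitz_on UNIV H"
    and H_monotone: "\<And>u v. 0 \<le> (H u - H v) \<bullet> (u - v)"
    and saddle: "grad F zstar + H zstar = 0"
    and H_oracle: "\<And>k. unbiased_oracle M S (\<zeta> k) Ht H \<sigma>H"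
    and F_oracle: "\<And>k. unbiased_oracle M T (\<xi> k) Ft (grad F) \<sigma>F"
    and z0_L2: "integrable M (\<lambda>\<omega>. (norm (z 0 \<omega>))\<^sup>2)"
    and \<eta>_nonneg: "\<And>k. 0 \<le> \<eta> k"
    and \<eta>_L: "\<And>k. 4 * L * \<eta> k \<le> real k + 2"
    and \<eta>_LH: "\<And>k. 4 * (\<eta> k * LH)\<^sup>2 \<le> (2 - sqrt 2) / 2"
    and \<eta>_ratio: "\<And>k. (real k + 1) * \<eta> (Suc k) \<le> (real k + 2) * \<eta> k"
    and run: "\<And>\<omega>. \<omega> \<in> space M \<Longrightarrow> ag_og_run K (\<lambda>k. 2 / (real k + 2)) \<eta> Ht Ft
      (\<lambda>k. \<zeta> k \<omega>) (\<lambda>k. \<xi> k \<omega>) (\<lambda>k. z k \<omega>) (\<lambda>k. zh k \<omega>) (\<lambda>k. zag k \<omega>) (\<lambda>k. zmd k \<omega>)"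
begin

text \<open>Separate counters are needed because a step reveals its gradient noise before its new
  operator noise. The operator counter inherits the half-index shift of
  \<open>\<zeta>\<close>.\<close>

definition hist :: "nat \<Rightarrow> nat \<Rightarrow> 'w measure" where
  "hist a b = past (insert Init (OpNoise ` {..<a} \<union> GradNoise ` {..<b}))"

lemma subalgebra_hist: "subalgebra M (hist a b)"
  unfolding hist_def by (rule subalgebra_past)

lemma space_hist: "space (hist a b) = space M"
  unfolding hist_def by (rule space_past)

lemma subalgebra_hist_mono: "a \<le> a' \<Longrightarrow> b \<le> b' \<Longrightarrow> subalgebra (hist a' b') (hist a b)"
  unfolding hist_def by (rule subalgebra_past_mono) auto

lemma grad_F_lipschitz: "L-lipschitz_on UNIV (grad F)"
  using F_smooth by (simp add: smooth_fun_def)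

lemma lipschitz_borel: "c-lipschitz_on UNIV G \<Longrightarrow> G \<in> borel_measurable borel"
  for G :: "'z \<Rightarrow> 'z"
  by (intro borel_measurable_continuous_onI lipschitz_on_continuous_on)

lemma hist_indep_\<zeta>:
  assumes "A \<in> sets (hist k b)" "B \<in> sets S"
  shows "prob (A \<inter> (\<zeta> k -` B \<inter> space M)) = prob A * prob (\<zeta> k -` B \<inter> space M)"
  using assms(1) unfolding hist_def by (rule past_indep_OpNoise[rotated]) (use assms(2) in auto)

lemma hist_indep_\<xi>:
  assumes "A \<in> sets (hist a k)" "B \<in> sets T"
  shows "prob (A \<inter> (\<xi> k -` B \<inter> space M)) = prob A * prob (\<xi> k -` B \<inter> space M)"
  using assms(1) unfolding hist_def by (rule past_indep_GradNoise[rotated]) (use assms(2) in auto)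

lemma L2_Ht:
  assumes "L2_on (hist k b) M X"
  shows "L2_on (hist (Suc k) b) M (\<lambda>\<omega>. Ht (X \<omega>) (\<zeta> k \<omega>))"
proof (rule L2_on_oracle[OF H_oracle lipschitz_borel[OF H_lipschitz] subalgebra_hist
      hist_indep_\<zeta> L2_on_measurable[OF assms] H_lipschitz assms subalgebra_hist_mono subalgebra_hist])
  show "\<zeta> k \<in> hist (Suc k) b \<rightarrow>\<^sub>M S"
    unfolding hist_def by (rule past_measurable(2)) auto
qed auto

lemma L2_Ft:
  assumes "L2_on (hist a k) M X"
  shows "L2_on (hist a (Suc k)) M (\<lambda>\<omega>. Ft (X \<omega>) (\<xi> k \<omega>))"
proof (rule L2_on_oracle[OF F_oracle lipschitz_borel[OF grad_F_lipschitz] subalgebra_hist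
      hist_indep_\<xi> L2_on_measurable[OF assms] grad_F_lipschitz assms subalgebra_hist_mono subalgebra_hist])
  show "\<xi> k \<in> hist a (Suc k) \<rightarrow>\<^sub>M T"
    unfolding hist_def by (rule past_measurable(3)) auto
qed auto

text \<open>Query and test vector must be known before \<open>\<zeta> k\<close>; the gradient
  counter \<open>b\<close> stays free, as gradient noise of any index is independent of
  \<open>\<zeta> k\<close>.\<close>

lemma H_noise:
  assumes "L2_on (hist k b) M X"
  shows "integrable M (\<lambda>\<omega>. (norm (Ht (X \<omega>) (\<zeta> k \<omega>) - H (X \<omega>)))\<^sup>2)"
    and "(\<integral>\<omega>. (norm (Ht (X \<omega>) (\<zeta> k \<omega>) - H (X \<omega>)))\<^sup>2 \<partial>M) \<le> \<sigma>H\<^sup>2"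
    and "L2_on (hist k b) M U \<Longrightarrow> integrable M (\<lambda>\<omega>. (Ht (X \<omega>) (\<zeta> k \<omega>) - H (X \<omega>)) \<bullet> U \<omega>)"
    and "L2_on (hist k b) M U \<Longrightarrow> (\<integral>\<omega>. (Ht (X \<omega>) (\<zeta> k \<omega>) - H (X \<omega>)) \<bullet> U \<omega> \<partial>M) = 0"
  by (rule oracle_noise_sq[OF H_oracle lipschitz_borel[OF H_lipschitz] subalgebra_hist
        hist_indep_\<zeta> L2_on_measurable[OF assms]]
      oracle_noise_inner[OF H_oracle lipschitz_borel[OF H_lipschitz] subalgebra_hist
        hist_indep_\<zeta> L2_on_measurable[OF assms]]; assumption)+

lemma F_noise:
  assumes "L2_on (hist a k) M X"
  shows "integrable M (\<lambda>\<omega>. (norm (Ft (X \<omega>) (\<xi> k \<omega>) - grad F (X \<omega>)))\<^sup>2)"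
    and "(\<integral>\<omega>. (norm (Ft (X \<omega>) (\<xi> k \<omega>) - grad F (X \<omega>)))\<^sup>2 \<partial>M) \<le> \<sigma>F\<^sup>2"
    and "L2_on (hist a k) M U \<Longrightarrow> integrable M (\<lambda>\<omega>. (Ft (X \<omega>) (\<xi> k \<omega>) - grad F (X \<omega>)) \<bullet> U \<omega>)"
    and "L2_on (hist a k) M U \<Longrightarrow> (\<integral>\<omega>. (Ft (X \<omega>) (\<xi> k \<omega>) - grad F (X \<omega>)) \<bullet> U \<omega> \<partial>M) = 0"
  by (rule oracle_noise_sq[OF F_oracle lipschitz_borel[OF grad_F_lipschitz] subalgebra_hist
        hist_indep_\<xi> L2_on_measurable[OF assms]]
      oracle_noise_inner[OF F_oracle lipschitz_borel[OF grad_F_lipschitz] subalgebra_hist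
        hist_indep_\<xi> L2_on_measurable[OF assms]]; assumption)+

lemma run_init:
  assumes "\<omega> \<in> space M"
  shows "zh 0 \<omega> = z 0 \<omega>" "zag 0 \<omega> = z 0 \<omega>"
  using run[OF assms] by (simp_all add: ag_og_run_def)

lemma run_step:
  assumes "\<omega> \<in> space M" "k < K"
  shows "zmd k \<omega> = (1 - 2 / (real k + 2)) *\<^sub>R zag k \<omega> + (2 / (real k + 2)) *\<^sub>R z k \<omega>"
    and "zh (Suc k) \<omega> = z k \<omega> - \<eta> k *\<^sub>R (Ht (zh k \<omega>) (\<zeta> k \<omega>) + Ft (zmd k \<omega>) (\<xi> k \<omega>))"
    and "zag (Suc k) \<omega> = (1 - 2 / (real k + 2)) *\<^sub>R zag k \<omega> + (2 / (real k + 2)) *\<^sub>R zh (Suc k) \<omega>"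
    and "z (Suc k) \<omega> = z k \<omega> - \<eta> k *\<^sub>R (Ht (zh (Suc k) \<omega>) (\<zeta> (Suc k) \<omega>) + Ft (zmd k \<omega>) (\<xi> k \<omega>))"
  using run[OF assms(1)] assms(2) unfolding ag_og_run_def by blast+

section \<open>Information content and square integrability of the iterates\<close>

lemmas L2_mono = L2_on_mono[OF _ subalgebra_hist_mono]
lemmas L2_add = L2_on_add[OF subalgebra_hist] and L2_diff = L2_on_diff[OF subalgebra_hist]
lemmas L2_cong = L2_on_cong[OF _ _ space_hist]

lemma L2_zmd:
  assumes "k < K" "L2_on (hist k k) M (zag k)" "L2_on (hist (Suc k) k) M (z k)"
  shows "L2_on (hist (Suc k) k) M (zmd k)"
proof (rule L2_cong)
  show "L2_on (hist (Suc k) k) M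
      (\<lambda>\<omega>. (1 - 2 / (real k + 2)) *\<^sub>R zag k \<omega> + (2 / (real k + 2)) *\<^sub>R z k \<omega>)"
    by (intro L2_add L2_on_scaleR assms L2_mono[OF assms(2)]) auto
qed (rule run_step(1)[OF _ assms(1)])

text \<open>\<open>zh k\<close> and \<open>zag k\<close> are known before \<open>\<zeta> k\<close>,
  whereas \<open>z k\<close> may already contain it. This offset makes the noise of the sample at
  \<open>zh k\<close> orthogonal to the past.\<close>

lemma L2_iterates:
  "k \<le> K \<Longrightarrow> L2_on (hist k k) M (zh k) \<and> L2_on (hist k k) M (zag k) \<and> L2_on (hist (Suc k) k) M (z k)"
proof (induction k)
  case 0
  have z0: "L2_on (hist a b) M (z 0)" for a b
    unfolding L2_on_def hist_def using z0_L2 past_measurable(1) by blast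
  show ?case
    by (intro conjI z0 L2_cong[OF z0[of 0 0]] run_init)
next
  case (Suc k)
  then have k: "k < K" and IH: "L2_on (hist k k) M (zh k)" "L2_on (hist k k) M (zag k)"
    "L2_on (hist (Suc k) k) M (z k)" by auto
  note Ft = L2_Ft[OF L2_zmd[OF k IH(2,3)]]
  have zh: "L2_on (hist (Suc k) (Suc k)) M (zh (Suc k))"
  proof (rule L2_cong)
    show "L2_on (hist (Suc k) (Suc k)) M
        (\<lambda>\<omega>. z k \<omega> - \<eta> k *\<^sub>R (Ht (zh k \<omega>) (\<zeta> k \<omega>) + Ft (zmd k \<omega>) (\<xi> k \<omega>)))"
      by (intro L2_diff L2_add L2_on_scaleR Ft L2_mono[OF IH(3)] L2_mono[OF L2_Ht[OF IH(1)]]) auto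
  qed (rule run_step(2)[OF _ k])
  moreover have "L2_on (hist (Suc k) (Suc k)) M (zag (Suc k))"
  proof (rule L2_cong)
    show "L2_on (hist (Suc k) (Suc k)) M
        (\<lambda>\<omega>. (1 - 2 / (real k + 2)) *\<^sub>R zag k \<omega> + (2 / (real k + 2)) *\<^sub>R zh (Suc k) \<omega>)"
      by (intro L2_add L2_on_scaleR zh L2_mono[OF IH(2)]) auto
  qed (rule run_step(3)[OF _ k])
  moreover have "L2_on (hist (Suc (Suc k)) (Suc k)) M (z (Suc k))"
  proof (rule L2_cong)
    show "L2_on (hist (Suc (Suc k)) (Suc k)) M
        (\<lambda>\<omega>. z k \<omega> - \<eta> k *\<^sub>R (Ht (zh (Suc k) \<omega>) (\<zeta> (Suc k) \<omega>) + Ft (zmd k \<omega>) (\<xi> k \<omega>)))"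
      by (intro L2_diff L2_add L2_on_scaleR L2_mono[OF Ft] L2_mono[OF IH(3)] L2_Ht[OF zh]) auto
  qed (rule run_step(4)[OF _ k])
  ultimately show ?case by blast
qed

lemmas L2_zh = L2_iterates[THEN conjunct1]
  and L2_zag = L2_iterates[THEN conjunct2, THEN conjunct1]
  and L2_z = L2_iterates[THEN conjunct2, THEN conjunct2]

text \<open>By the saddle equation \<open>H zstar = - grad F zstar\<close>, this is the Bregman
  divergence of \<open>F\<close> at \<open>zstar\<close>.\<close>

definition Q :: "'z \<Rightarrow> real" where
  "Q w = F w - F zstar + H zstar \<bullet> (w - zstar)"

lemma Q_bounds: "\<mu> / 2 * (norm (w - zstar))\<^sup>2 \<le> Q w" "Q w \<le> L / 2 * (norm (w - zstar))\<^sup>2"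
proof -
  have H: "H zstar = - grad F zstar" using saddle by (simp add: eq_neg_iff_add_eq_0 add.commute)
  have "GDERIV F zstar :> grad F zstar"
    using F_smooth by (auto simp: smooth_fun_def intro: GDERIV_grad)
  from strongly_convex_lower_bound[OF F_convex this, of w] descent_lemma[OF F_smooth, of w zstar]
  show "\<mu> / 2 * (norm (w - zstar))\<^sup>2 \<le> Q w" "Q w \<le> L / 2 * (norm (w - zstar))\<^sup>2"
    by (simp_all add: Q_def H)
qed

lemma Q_nonneg: "0 \<le> Q w"
  using Q_bounds(1)[of w] \<mu>_pos by (smt (verit) divide_nonneg_nonneg mult_nonneg_nonneg zero_le_power2)

lemma integrable_norm_sq_diff:
  assumes "L2_on (hist a b) M X" "L2_on (hist a' b') M Y"
  shows "integrable M (\<lambda>\<omega>. (norm (X \<omega> - Y \<omega>))\<^sup>2)"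
  using L2_diff[OF L2_mono[OF assms(1), of "max a a'" "max b b'"] L2_mono[OF assms(2), of "max a a'" "max b b'"]]
  by (simp add: L2_on_def)

lemma integrable_norm_sq_diff_zstar:
  assumes "L2_on (hist a b) M X"
  shows "integrable M (\<lambda>\<omega>. (norm (X \<omega> - zstar))\<^sup>2)"
  using integrable_norm_sq_diff[OF assms L2_on_const[OF finite_measure_axioms]] .

text \<open>\<open>Q\<close> lies between 0 and a multiple of the squared distance to
  \<open>zstar\<close>.\<close>

lemma integrable_Q:
  assumes X: "L2_on (hist a b) M X"
  shows "integrable M (\<lambda>\<omega>. Q (X \<omega>))"
proof (rule Bochner_Integration.integrable_bound)
  show "integrable M (\<lambda>\<omega>. L / 2 * (norm (X \<omega> - zstar))\<^sup>2)"
    by (intro integrable_mult_right integrable_norm_sq_diff_zstar[OF X])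
  have "continuous_on UNIV F"
    using F_smooth differentiable_imp_continuous_within
    unfolding smooth_fun_def continuous_on_eq_continuous_within by blast
  then have "continuous_on UNIV Q"
    unfolding Q_def by (intro continuous_intros)
  then have "Q \<in> borel_measurable borel" by (rule borel_measurable_continuous_onI)
  moreover have "X \<in> borel_measurable M"
    using measurable_from_subalg[OF subalgebra_hist L2_on_measurable[OF X]] .
  ultimately show "(\<lambda>\<omega>. Q (X \<omega>)) \<in> borel_measurable M"
    by (rule measurable_compose[rotated])
  show "AE \<omega> in M. norm (Q (X \<omega>)) \<le> norm (L / 2 * (norm (X \<omega> - zstar))\<^sup>2)"
    using Q_nonneg Q_bounds(2) by (intro AE_I2) (smt (verit) real_norm_def)
qed

text \<open>For \<open>k \<ge> 1\<close> the quantity \<open>dev k\<close> is the expected squared distance of two consecutive operator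
  samples, scaled by the squared step size: the two updates of a step differ only in that sample.\<close>

definition dev :: "nat \<Rightarrow> real" where
  "dev k = (\<integral>\<omega>. (norm (z k \<omega> - zh k \<omega>))\<^sup>2 \<partial>M)"

definition move :: "nat \<Rightarrow> real" where
  "move k = (\<integral>\<omega>. (norm (zh (Suc k) \<omega> - z k \<omega>))\<^sup>2 \<partial>M)"

text \<open>The fresh noise \<open>\<epsilon>'\<close> is orthogonal to \<open>Y\<close>. The old
  noise \<open>\<epsilon>\<close> need not be orthogonal to the rest of \<open>Y\<close>, since
  \<open>zh (Suc k)\<close> depends on \<open>\<zeta> k\<close>; there the square of a sum costs a
  factor 2. This gives 1 + 2 = 3 copies of the variance.\<close>

lemma dev_step:
  assumes k: "k < K"
  shows "dev (Suc k) \<le> 3 * (\<eta> k)\<^sup>2 * \<sigma>H\<^sup>2 + 4 * (\<eta> k * LH)\<^sup>2 * (move k + dev k)"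
proof -
  have zh: "L2_on (hist k k) M (zh k)" and zh': "L2_on (hist (Suc k) (Suc k)) M (zh (Suc k))"
    and z: "L2_on (hist (Suc k) k) M (z k)"
    using k by (auto intro: L2_zh L2_z)
  define \<epsilon> where "\<epsilon> \<omega> = Ht (zh k \<omega>) (\<zeta> k \<omega>) - H (zh k \<omega>)" for \<omega>
  define \<epsilon>' where "\<epsilon>' \<omega> = Ht (zh (Suc k) \<omega>) (\<zeta> (Suc k) \<omega>) - H (zh (Suc k) \<omega>)" for \<omega>
  define Y where "Y \<omega> = H (zh (Suc k) \<omega>) - Ht (zh k \<omega>) (\<zeta> k \<omega>)" for \<omega>
  have Y: "L2_on (hist (Suc k) (Suc k)) M Y"
    unfolding Y_def
    by (intro L2_diff L2_on_lipschitz[OF finite_measure_axioms subalgebra_hist zh' H_lipschitz]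
        L2_mono[OF L2_Ht[OF zh]]) auto
  note \<epsilon> = H_noise[OF zh, folded \<epsilon>_def]
  note \<epsilon>' = H_noise[OF zh', folded \<epsilon>'_def]
  have int: "integrable M (\<lambda>\<omega>. (norm (zh (Suc k) \<omega> - z k \<omega>))\<^sup>2)"
    "integrable M (\<lambda>\<omega>. (norm (z k \<omega> - zh k \<omega>))\<^sup>2)"
    by (rule integrable_norm_sq_diff[OF zh' z] integrable_norm_sq_diff[OF z zh])+
  \<comment> \<open>The second factor 2 in the 4 comes from passing between the two half steps
    through \<open>z k\<close>.\<close>
  have "(norm (Y \<omega>))\<^sup>2 \<le> 4 * LH\<^sup>2 * ((norm (zh (Suc k) \<omega> - z k \<omega>))\<^sup>2 + (norm (z k \<omega> - zh k \<omega>))\<^sup>2)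
      + 2 * (norm (\<epsilon> \<omega>))\<^sup>2" for \<omega>
  proof -
    have "(norm (Y \<omega>))\<^sup>2 \<le> 2 * (norm (H (zh (Suc k) \<omega>) - H (zh k \<omega>)))\<^sup>2 + 2 * (norm (- \<epsilon> \<omega>))\<^sup>2"
      using norm_add_sq_le[of "H (zh (Suc k) \<omega>) - H (zh k \<omega>)" "- \<epsilon> \<omega>"]
      by (simp add: Y_def \<epsilon>_def)
    moreover have "norm (H (zh (Suc k) \<omega>) - H (zh k \<omega>)) \<le> LH * norm (zh (Suc k) \<omega> - zh k \<omega>)"
      using lipschitz_onD[OF H_lipschitz, of "zh (Suc k) \<omega>" "zh k \<omega>"] by (simp add: dist_norm)
    then have "(norm (H (zh (Suc k) \<omega>) - H (zh k \<omega>)))\<^sup>2 \<le> LH\<^sup>2 * (norm (zh (Suc k) \<omega> - zh k \<omega>))\<^sup>2"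
      unfolding power_mult_distrib[symmetric] by (rule power_mono) simp
    moreover have "LH\<^sup>2 * (norm (zh (Suc k) \<omega> - zh k \<omega>))\<^sup>2
        \<le> LH\<^sup>2 * (2 * (norm (zh (Suc k) \<omega> - z k \<omega>))\<^sup>2 + 2 * (norm (z k \<omega> - zh k \<omega>))\<^sup>2)"
      using norm_add_sq_le[of "zh (Suc k) \<omega> - z k \<omega>" "z k \<omega> - zh k \<omega>"]
      by (intro mult_left_mono) auto
    ultimately show ?thesis by (simp add: distrib_left)
  qed
  then have "(\<integral>\<omega>. (norm (Y \<omega>))\<^sup>2 \<partial>M) \<le> (\<integral>\<omega>. 4 * LH\<^sup>2 * ((norm (zh (Suc k) \<omega> - z k \<omega>))\<^sup>2
      + (norm (z k \<omega> - zh k \<omega>))\<^sup>2) + 2 * (norm (\<epsilon> \<omega>))\<^sup>2 \<partial>M)"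
    using L2_on_integrable[OF Y] int \<epsilon>(1) by (intro integral_mono) auto
  also have "\<dots> = 4 * LH\<^sup>2 * (move k + dev k) + 2 * (\<integral>\<omega>. (norm (\<epsilon> \<omega>))\<^sup>2 \<partial>M)"
    using int \<epsilon>(1) by (simp add: move_def dev_def)
  finally have EY: "(\<integral>\<omega>. (norm (Y \<omega>))\<^sup>2 \<partial>M) \<le> 4 * LH\<^sup>2 * (move k + dev k) + 2 * \<sigma>H\<^sup>2"
    using \<epsilon>(2) by linarith
  have "dev (Suc k) = (\<integral>\<omega>. (\<eta> k)\<^sup>2 * ((norm (\<epsilon>' \<omega>))\<^sup>2 + 2 * (\<epsilon>' \<omega> \<bullet> Y \<omega>) + (norm (Y \<omega>))\<^sup>2) \<partial>M)"
    unfolding dev_def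
  proof (rule Bochner_Integration.integral_cong[OF refl])
    fix \<omega> assume "\<omega> \<in> space M"
    then have "z (Suc k) \<omega> - zh (Suc k) \<omega> = (- \<eta> k) *\<^sub>R (\<epsilon>' \<omega> + Y \<omega>)"
      using k by (simp add: run_step \<epsilon>'_def Y_def algebra_simps)
    moreover have "(norm (\<epsilon>' \<omega> + Y \<omega>))\<^sup>2 = (norm (\<epsilon>' \<omega>))\<^sup>2 + 2 * (\<epsilon>' \<omega> \<bullet> Y \<omega>) + (norm (Y \<omega>))\<^sup>2"
      by (simp add: power2_norm_eq_inner inner_add_left inner_add_right inner_commute)
    ultimately show "(norm (z (Suc k) \<omega> - zh (Suc k) \<omega>))\<^sup>2
        = (\<eta> k)\<^sup>2 * ((norm (\<epsilon>' \<omega>))\<^sup>2 + 2 * (\<epsilon>' \<omega> \<bullet> Y \<omega>) + (norm (Y \<omega>))\<^sup>2)"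
      by (simp add: power_mult_distrib)
  qed
  also have "\<dots> = (\<eta> k)\<^sup>2 * ((\<integral>\<omega>. (norm (\<epsilon>' \<omega>))\<^sup>2 \<partial>M) + (\<integral>\<omega>. (norm (Y \<omega>))\<^sup>2 \<partial>M))"
    using \<epsilon>'(1) \<epsilon>'(3,4)[OF Y] L2_on_integrable[OF Y] by simp
  also have "\<dots> \<le> (\<eta> k)\<^sup>2 * (\<sigma>H\<^sup>2 + (4 * LH\<^sup>2 * (move k + dev k) + 2 * \<sigma>H\<^sup>2))"
    using \<epsilon>'(2) EY by (intro mult_left_mono add_mono) auto
  finally show ?thesis by (simp add: power_mult_distrib algebra_simps)
qed

definition gap :: "nat \<Rightarrow> real" where
  "gap k = (\<integral>\<omega>. Q (zag k \<omega>) \<partial>M)"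

definition err :: "nat \<Rightarrow> real" where
  "err k = (\<integral>\<omega>. (norm (z k \<omega> - zstar))\<^sup>2 \<partial>M)"

text \<open>The half step contains the gradient noise \<open>\<delta>\<close> only through the
  summand \<open>- \<eta> k *\<^sub>R \<delta> \<omega>\<close>. Its inner product with
  \<open>\<delta>\<close> therefore contributes the variance term, and all other noise products
  average to zero.\<close>

lemma gap_step:
  assumes k: "k < K"
  shows "(real k + 2) * \<eta> k * gap (Suc k) + err (Suc k)
    \<le> real k * \<eta> k * gap k + err k + dev (Suc k) - move k / 2 + 2 * (\<eta> k)\<^sup>2 * \<sigma>F\<^sup>2"
proof -
  have zh: "L2_on (hist k k) M (zh k)" and zh': "L2_on (hist (Suc k) (Suc k)) M (zh (Suc k))"
    and z: "L2_on (hist (Suc k) k) M (z k)" and z': "L2_on (hist (Suc (Suc k)) (Suc k)) M (z (Suc k))"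
    and w: "L2_on (hist k k) M (zag k)" and w': "L2_on (hist (Suc k) (Suc k)) M (zag (Suc k))"
    using k by (auto intro: L2_zh L2_z L2_zag)
  have m: "L2_on (hist (Suc k) k) M (zmd k)" using k w z by (rule L2_zmd)
  define \<epsilon> where "\<epsilon> \<omega> = Ht (zh (Suc k) \<omega>) (\<zeta> (Suc k) \<omega>) - H (zh (Suc k) \<omega>)" for \<omega>
  define \<delta> where "\<delta> \<omega> = Ft (zmd k \<omega>) (\<xi> k \<omega>) - grad F (zmd k \<omega>)" for \<omega>
  define X where "X \<omega> = zh (Suc k) \<omega> - zstar" for \<omega>
  \<comment> \<open>The half step with the exact gradient, relative to \<open>zstar\<close>; it is
    known before \<open>\<xi> k\<close>.\<close>
  define Y where "Y \<omega> = z k \<omega> - \<eta> k *\<^sub>R (Ht (zh k \<omega>) (\<zeta> k \<omega>) + grad F (zmd k \<omega>)) - zstar" for \<omega>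
  have X: "L2_on (hist (Suc k) (Suc k)) M X"
    unfolding X_def by (intro L2_diff zh' L2_on_const finite_measure_axioms)
  have Y: "L2_on (hist (Suc k) k) M Y"
    unfolding Y_def
    by (intro L2_diff L2_add L2_on_scaleR z L2_Ht[OF zh] L2_on_const finite_measure_axioms
        L2_on_lipschitz[OF finite_measure_axioms subalgebra_hist m grad_F_lipschitz])
  note \<epsilon> = H_noise[OF zh', folded \<epsilon>_def]
  note \<delta> = F_noise[OF m, folded \<delta>_def]
  note int = integrable_Q[OF w] integrable_Q[OF w'] integrable_norm_sq_diff_zstar[OF z]
    integrable_norm_sq_diff_zstar[OF z'] integrable_norm_sq_diff[OF z' zh']
    integrable_norm_sq_diff[OF zh' z] \<delta>(1) \<delta>(3)[OF Y] \<epsilon>(3)[OF X]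
  have "(real k + 2) * \<eta> k * Q (zag (Suc k) \<omega>) + (norm (z (Suc k) \<omega> - zstar))\<^sup>2
      \<le> real k * \<eta> k * Q (zag k \<omega>) + (norm (z k \<omega> - zstar))\<^sup>2
        + (norm (z (Suc k) \<omega> - zh (Suc k) \<omega>))\<^sup>2 - (norm (zh (Suc k) \<omega> - z k \<omega>))\<^sup>2 / 2
        + 2 * (\<eta> k)\<^sup>2 * (norm (\<delta> \<omega>))\<^sup>2 - 2 * \<eta> k * (\<delta> \<omega> \<bullet> Y \<omega>) - 2 * \<eta> k * (\<epsilon> \<omega> \<bullet> X \<omega>)"
    if \<omega>: "\<omega> \<in> space M" for \<omega>
  proof -
    note step = run_step[OF \<omega> k]
    have "z (Suc k) \<omega> - zh (Suc k) \<omega>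
        = (- \<eta> k) *\<^sub>R (Ht (zh (Suc k) \<omega>) (\<zeta> (Suc k) \<omega>) - Ht (zh k \<omega>) (\<zeta> k \<omega>))"
      unfolding step(2,4) by (simp add: algebra_simps)
    then have dev: "(\<eta> k)\<^sup>2 * (norm (Ht (zh (Suc k) \<omega>) (\<zeta> (Suc k) \<omega>) - Ht (zh k \<omega>) (\<zeta> k \<omega>)))\<^sup>2
        = (norm (z (Suc k) \<omega> - zh (Suc k) \<omega>))\<^sup>2"
      by (simp add: power_mult_distrib)
    have "X \<omega> = Y \<omega> - \<eta> k *\<^sub>R \<delta> \<omega>"
      using step(2) by (simp add: X_def Y_def \<delta>_def algebra_simps)
    then have eq: "\<delta> \<omega> \<bullet> X \<omega> = \<delta> \<omega> \<bullet> Y \<omega> - \<eta> k * (norm (\<delta> \<omega>))\<^sup>2"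
      by (simp add: inner_diff_right power2_norm_eq_inner)
    have \<delta>X: "2 * \<eta> k * (\<delta> \<omega> \<bullet> X \<omega>) = 2 * \<eta> k * (\<delta> \<omega> \<bullet> Y \<omega>) - 2 * (\<eta> k)\<^sup>2 * (norm (\<delta> \<omega>))\<^sup>2"
      unfolding eq by (simp add: power2_eq_square[of "\<eta> k"] algebra_simps)
    \<comment> \<open>The bound on \<open>L * \<eta> k\<close> keeps at least half of the negative
      half-step term, later spent on \<open>dev\<close>.\<close>
    have "1 / 2 \<le> 1 - 2 * L * \<eta> k / (real k + 2)"
      using \<eta>_L[of k] by (simp add: field_simps)
    then have "1 / 2 * (norm (zh (Suc k) \<omega> - z k \<omega>))\<^sup>2
        \<le> (1 - 2 * L * \<eta> k / (real k + 2)) * (norm (zh (Suc k) \<omega> - z k \<omega>))\<^sup>2"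
      by (rule mult_right_mono) simp
    moreover note ag_og_step[OF F_convex less_imp_le[OF \<mu>_pos] F_smooth H_monotone \<eta>_nonneg step(1) step(2) step(3) step(4),
        where zs = zstar, folded Q_def \<delta>_def \<epsilon>_def, folded X_def, unfolded dev \<delta>X]
    ultimately show ?thesis by linarith
  qed
  then have "(\<integral>\<omega>. (real k + 2) * \<eta> k * Q (zag (Suc k) \<omega>) + (norm (z (Suc k) \<omega> - zstar))\<^sup>2 \<partial>M)
      \<le> (\<integral>\<omega>. real k * \<eta> k * Q (zag k \<omega>) + (norm (z k \<omega> - zstar))\<^sup>2
        + (norm (z (Suc k) \<omega> - zh (Suc k) \<omega>))\<^sup>2 - (norm (zh (Suc k) \<omega> - z k \<omega>))\<^sup>2 / 2
        + 2 * (\<eta> k)\<^sup>2 * (norm (\<delta> \<omega>))\<^sup>2 - 2 * \<eta> k * (\<delta> \<omega> \<bullet> Y \<omega>) - 2 * \<eta> k * (\<epsilon> \<omega> \<bullet> X \<omega>) \<partial>M)"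
    using int by (intro integral_mono) auto
  then have "(real k + 2) * \<eta> k * gap (Suc k) + err (Suc k)
      \<le> real k * \<eta> k * gap k + err k + dev (Suc k) - move k / 2
        + 2 * (\<eta> k)\<^sup>2 * (\<integral>\<omega>. (norm (\<delta> \<omega>))\<^sup>2 \<partial>M)"
    using int by (simp add: gap_def err_def dev_def move_def \<delta>(4)[OF Y] \<epsilon>(4)[OF X])
  moreover have "2 * (\<eta> k)\<^sup>2 * (\<integral>\<omega>. (norm (\<delta> \<omega>))\<^sup>2 \<partial>M) \<le> 2 * (\<eta> k)\<^sup>2 * \<sigma>F\<^sup>2"
    using \<delta>(2) by (intro mult_left_mono) auto
  ultimately show ?thesis by linarith
qed

lemma gap_nonneg: "0 \<le> gap k" and move_nonneg: "0 \<le> move k" and dev_nonneg: "0 \<le> dev k"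
  and err_nonneg: "0 \<le> err k"
  by (simp_all add: gap_def move_def dev_def err_def Q_nonneg)

text \<open>The weight \<open>\<lambda> = sqrt 2 - 1\<close> solves \<open>(1 + \<lambda>) \<kappa> = \<lambda>\<close> for the contraction factor
  \<open>\<kappa> = (2 - sqrt 2) / 2\<close> of \<open>dev\<close>, which makes the potential non-increasing up to noise.\<close>

lemma potential_step:
  assumes k: "k < K"
  shows "(real k + 2) * \<eta> k * gap (Suc k) + err (Suc k) + (sqrt 2 - 1) * dev (Suc k)
    \<le> real k * \<eta> k * gap k + err k + (sqrt 2 - 1) * dev k
      + (3 * sqrt 2 * \<sigma>H\<^sup>2 + 2 * \<sigma>F\<^sup>2) * (\<eta> k)\<^sup>2"
proof -
  have "4 * (\<eta> k * LH)\<^sup>2 * (move k + dev k) \<le> (2 - sqrt 2) / 2 * (move k + dev k)"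
    using \<eta>_LH move_nonneg dev_nonneg by (intro mult_right_mono add_nonneg_nonneg) auto
  then have "dev (Suc k) \<le> 3 * (\<eta> k)\<^sup>2 * \<sigma>H\<^sup>2 + (2 - sqrt 2) / 2 * (move k + dev k)"
    using dev_step[OF k] by linarith
  \<comment> \<open>The factor is 1 plus the weight \<open>sqrt 2 - 1\<close>: one copy of
    \<open>dev (Suc k)\<close> comes from \<open>gap_step\<close>, the rest from the
    potential.\<close>
  then have "sqrt 2 * dev (Suc k)
      \<le> sqrt 2 * (3 * (\<eta> k)\<^sup>2 * \<sigma>H\<^sup>2 + (2 - sqrt 2) / 2 * (move k + dev k))"
    by (rule mult_left_mono) simp
  also have "\<dots> = 3 * sqrt 2 * \<sigma>H\<^sup>2 * (\<eta> k)\<^sup>2 + (sqrt 2 * ((2 - sqrt 2) / 2)) * (move k + dev k)"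
    by (simp only: distrib_left mult_ac)
  also have "sqrt 2 * ((2 - sqrt 2) / 2) = sqrt 2 - (1::real)"
    by (simp add: field_simps)
  finally have "sqrt 2 * dev (Suc k)
      \<le> 3 * sqrt 2 * \<sigma>H\<^sup>2 * (\<eta> k)\<^sup>2 + (sqrt 2 - 1) * (move k + dev k)" .
  \<comment> \<open>So the negative half of \<open>move k\<close> in \<open>gap_step\<close> absorbs
    this term.\<close>
  moreover have "(sqrt 2 - 1) * move k \<le> 1 / 2 * move k"
  proof (intro mult_right_mono move_nonneg)
    have "sqrt 2 \<le> 3 / (2::real)"
      by (rule real_le_lsqrt) (simp_all add: power2_eq_square)
    then show "sqrt 2 - 1 \<le> 1 / (2::real)" by simp
  qed
  ultimately show ?thesis
    using gap_step[OF k] by (simp add: algebra_simps)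
qed

lemma potential_bound:
  "k < K \<Longrightarrow> (real k + 2) * \<eta> k * gap (Suc k) + err (Suc k) + (sqrt 2 - 1) * dev (Suc k)
    \<le> err 0 + (3 * sqrt 2 * \<sigma>H\<^sup>2 + 2 * \<sigma>F\<^sup>2) * (\<Sum>j\<le>k. (\<eta> j)\<^sup>2)"
proof (induction k)
  case 0
  \<comment> \<open>\<open>zh 0 = z 0\<close> makes the initial deviation vanish, and the
    coefficient \<open>real 0\<close> removes the initial gap, so only \<open>err 0\<close>
    remains.\<close>
  have "dev 0 = (\<integral>\<omega>. 0 \<partial>M)"
    unfolding dev_def by (rule Bochner_Integration.integral_cong[OF refl]) (simp add: run_init)
  then show ?case using potential_step[OF 0] by simp
next
  case (Suc k)
  \<comment> \<open>The gap weight demanded by the next step is at most the one the previous step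
    left.\<close>
  have "real (Suc k) * \<eta> (Suc k) * gap (Suc k) \<le> (real k + 2) * \<eta> k * gap (Suc k)"
    using \<eta>_ratio[of k] by (intro mult_right_mono gap_nonneg) (simp add: add.commute)
  then show ?case
    using Suc.IH Suc.prems potential_step[OF Suc.prems] by (simp add: distrib_left)
qed

text \<open>Dropping the nonnegative \<open>err\<close> and \<open>dev\<close> leaves the gap, which
  dominates the squared error. Integrability is stated too, because the Bochner integral of a
  non-integrable function is 0 and the bound alone would say little.\<close>

lemma expected_error:
  assumes "k < K"
  shows "integrable M (\<lambda>\<omega>. (norm (zag (Suc k) \<omega> - zstar))\<^sup>2)"
    and "\<mu> / 2 * ((real k + 2) * \<eta> k) * (\<integral>\<omega>. (norm (zag (Suc k) \<omega> - zstar))\<^sup>2 \<partial>M)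
      \<le> (\<integral>\<omega>. (norm (z 0 \<omega> - zstar))\<^sup>2 \<partial>M)
        + (3 * sqrt 2 * \<sigma>H\<^sup>2 + 2 * \<sigma>F\<^sup>2) * (\<Sum>j\<le>k. (\<eta> j)\<^sup>2)"
proof -
  have w: "L2_on (hist (Suc k) (Suc k)) M (zag (Suc k))"
    using assms by (auto intro: L2_zag)
  show int: "integrable M (\<lambda>\<omega>. (norm (zag (Suc k) \<omega> - zstar))\<^sup>2)"
    by (rule integrable_norm_sq_diff_zstar[OF w])
  have "(\<integral>\<omega>. \<mu> / 2 * (norm (zag (Suc k) \<omega> - zstar))\<^sup>2 \<partial>M) \<le> gap (Suc k)"
    unfolding gap_def using integrable_mult_right[OF int] integrable_Q[OF w] Q_bounds(1)
    by (rule integral_mono)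
  then have "((real k + 2) * \<eta> k) * (\<mu> / 2 * (\<integral>\<omega>. (norm (zag (Suc k) \<omega> - zstar))\<^sup>2 \<partial>M))
      \<le> ((real k + 2) * \<eta> k) * gap (Suc k)"
    using \<eta>_nonneg[of k] by (intro mult_left_mono) simp_all
  moreover have "0 \<le> (sqrt 2 - 1) * dev (Suc k)"
    using dev_nonneg by (intro mult_nonneg_nonneg) auto
  ultimately show "\<mu> / 2 * ((real k + 2) * \<eta> k) * (\<integral>\<omega>. (norm (zag (Suc k) \<omega> - zstar))\<^sup>2 \<partial>M)
      \<le> (\<integral>\<omega>. (norm (z 0 \<omega> - zstar))\<^sup>2 \<partial>M)
        + (3 * sqrt 2 * \<sigma>H\<^sup>2 + 2 * \<sigma>F\<^sup>2) * (\<Sum>j\<le>k. (\<eta> j)\<^sup>2)"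
    using potential_bound[OF assms] err_nonneg[of "Suc k"] unfolding err_def[of 0]
    by (simp add: mult_ac)
qed

end

section \<open>Step sizes and the convergence rate\<close>

text \<open>The square pyramidal formula up to \<open>k + 2\<close>; the \<open>- 1\<close> is the
  missing first square.\<close>

lemma sum_shifted_squares:
  "(\<Sum>j\<le>k. (real j + 2)\<^sup>2) = (real k + 2) * (real k + 3) * (2 * real k + 5) / 6 - 1"
  by (induction k) (simp_all add: field_simps power2_eq_square)

section \<open>Admissibility of the explicit step sizes\<close>

context
  fixes L LH D :: real and \<eta> :: "nat \<Rightarrow> real"
  assumes L: "0 < L" and LH: "0 \<le> LH" and D: "0 \<le> D"
    and \<eta>: "\<And>k. \<eta> k = (real k + 2) / (4 * L + D + 2 * sqrt (2 + sqrt 2) * LH * (real k + 2))"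
begin

lemma step_denominator:
  "4 * L + D \<le> 4 * L + D + 2 * sqrt (2 + sqrt 2) * LH * (real k + 2)"
  "0 < 4 * L + D + 2 * sqrt (2 + sqrt 2) * LH * (real k + 2)"
proof -
  have "0 \<le> 2 * sqrt (2 + sqrt 2) * LH * (real k + 2)"
    using LH by (intro mult_nonneg_nonneg) auto
  then show "4 * L + D \<le> 4 * L + D + 2 * sqrt (2 + sqrt 2) * LH * (real k + 2)"
    "0 < 4 * L + D + 2 * sqrt (2 + sqrt 2) * LH * (real k + 2)"
    using L D by linarith+
qed

lemma step_nonneg: "0 \<le> \<eta> k"
  unfolding \<eta> using step_denominator(2)[of k] by (intro divide_nonneg_pos) auto

lemma step_le: "(4 * L + D) * \<eta> k \<le> real k + 2"
proof -
  have "(4 * L + D) * (real k + 2)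
      \<le> (4 * L + D + 2 * sqrt (2 + sqrt 2) * LH * (real k + 2)) * (real k + 2)"
    by (intro mult_right_mono step_denominator) simp
  then show ?thesis
    unfolding \<eta> using step_denominator(2)[of k] by (simp add: pos_divide_le_eq mult.commute)
qed

lemma step_le_L: "4 * L * \<eta> k \<le> real k + 2"
  using step_le[of k] mult_nonneg_nonneg[OF D step_nonneg[of k]] by (simp add: distrib_right)

text \<open>The coupling term of the denominator alone gives
  \<open>2 * sqrt (2 + sqrt 2) * (\<eta> k * LH) \<le> 1\<close>. Squaring, and
  \<open>(2 - sqrt 2) * (2 + sqrt 2) = 2\<close>, produce exactly the contraction factor of
  \<open>dev\<close>.\<close>

lemma step_le_LH: "4 * (\<eta> k * LH)\<^sup>2 \<le> (2 - sqrt 2) / 2"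
proof -
  have "2 * sqrt (2 + sqrt 2) * LH * (real k + 2)
      \<le> 4 * L + D + 2 * sqrt (2 + sqrt 2) * LH * (real k + 2)"
    using L D by simp
  then have le: "2 * sqrt (2 + sqrt 2) * (\<eta> k * LH) \<le> 1"
    unfolding \<eta> using step_denominator(2)[of k] by (simp add: pos_divide_le_eq mult_ac)
  have "0 \<le> 2 * sqrt (2 + sqrt 2) * (\<eta> k * LH)"
    using LH step_nonneg by simp
  from power_mono[OF le this, of 2] have "(2 + sqrt 2) * (4 * (\<eta> k * LH)\<^sup>2) \<le> 1"
    by (simp add: power_mult_distrib algebra_simps)
  then have "(2 - sqrt 2) / 2 * ((2 + sqrt 2) * (4 * (\<eta> k * LH)\<^sup>2)) \<le> (2 - sqrt 2) / 2 * 1"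
    by (intro mult_left_mono) (auto intro: real_le_lsqrt)
  moreover have "(2 - sqrt 2) / 2 * (2 + sqrt 2) = (1::real)"
    by (simp add: field_simps)
  ultimately show ?thesis
    by (metis mult.assoc mult_1 mult.right_neutral)
qed

text \<open>\<open>(k + 1) * (k + 3) \<le> (k + 2)\<^sup>2\<close>, and the denominators do not
  decrease.\<close>

lemma step_ratio: "(real k + 1) * \<eta> (Suc k) \<le> (real k + 2) * \<eta> k"
proof -
  let ?d = "\<lambda>k. 4 * L + D + 2 * sqrt (2 + sqrt 2) * LH * (real k + 2)"
  have "(real k + 1) * \<eta> (Suc k) = (real k + 1) * (real k + 3) / ?d (Suc k)"
    by (simp add: \<eta> add.commute)
  also have "\<dots> \<le> (real k + 2)\<^sup>2 / ?d k"
    using LH step_denominator(2)[of k]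
    by (intro frac_le add_left_mono mult_left_mono) (auto simp: power2_eq_square algebra_simps)
  also have "\<dots> = (real k + 2) * \<eta> k"
    by (simp add: \<eta> power2_eq_square)
  finally show ?thesis .
qed

text \<open>Here \<open>k + 2\<close> is the number of steps plus one. The accumulated noise
  \<open>N\<close> is bounded by \<open>C\<^sup>2 * E0\<close>, and more sharply after
  multiplication by \<open>B\<close>; the sharper form keeps the factor \<open>1 + C\<^sup>2\<close>
  away from the \<open>L\<close> term.\<close>

lemma step_size_rate:
  fixes \<mu> \<sigma> C E0 R A :: real
  assumes \<mu>: "0 < \<mu>" and \<sigma>: "0 \<le> \<sigma>" and C: "0 < C" and E0: "0 < E0"
    and A: "A = sqrt ((real k + 2) * (real k + 3) * (2 * real k + 5) / 6)"
    and D_eq: "D = \<sigma> / C * (A / sqrt E0)"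
    and R: "\<mu> / 2 * ((real k + 2) * \<eta> k) * R \<le> E0 + \<sigma>\<^sup>2 * (\<Sum>j\<le>k. (\<eta> j)\<^sup>2)"
  shows "R \<le> (8 * L / (\<mu> * (real k + 2)\<^sup>2) + 7.4 * (1 + C\<^sup>2) * LH / (\<mu> * (real k + 2))) * E0
      + 2 * (C + 1 / C) * \<sigma> / (\<mu> * sqrt (real k + 2)) * sqrt E0"
proof -
  define B where "B = 4 * L + D"
  define n where "n = real k + 2"
  define c where "c = 2 * sqrt (2 + sqrt (2::real))"
  define N where "N = \<sigma>\<^sup>2 * (\<Sum>j\<le>k. (\<eta> j)\<^sup>2)"
  have n: "0 < n" and B: "0 < B" "D \<le> B" and c: "0 \<le> c"
    using L D by (auto simp: n_def B_def c_def)
  have A2: "A\<^sup>2 = n * (n + 1) * (2 * n + 1) / 6"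
    unfolding A by (simp add: n_def add.commute)
  \<comment> \<open>Equivalent to \<open>(n + 1) * (2 * n + 1) \<le> 6 * n\<^sup>2\<close>, valid
    because \<open>n\<close> is at least 2.\<close>
  have "A\<^sup>2 \<le> n\<^sup>2 * n"
    unfolding A2 by (simp add: n_def power2_eq_square field_simps)
  also have "\<dots> = (n * sqrt n)\<^sup>2"
    using n by (simp add: power_mult_distrib)
  finally have A_le: "A \<le> n * sqrt n"
    using n by (intro power2_le_imp_le[of A]) auto
  have DE: "C * D * sqrt E0 = \<sigma> * A"
    using C E0 by (simp add: D_eq)
  have "B\<^sup>2 * (\<Sum>j\<le>k. (\<eta> j)\<^sup>2) = (\<Sum>j\<le>k. (B * \<eta> j)\<^sup>2)"
    by (simp add: sum_distrib_left power_mult_distrib)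
  also have "\<dots> \<le> (\<Sum>j\<le>k. (real j + 2)\<^sup>2)"
    using step_le step_nonneg B(1) unfolding B_def[symmetric]
    by (intro sum_mono power_mono) auto
  also have "\<dots> \<le> A\<^sup>2"
    unfolding A2 sum_shifted_squares by (simp add: n_def algebra_simps)
  finally have "\<sigma>\<^sup>2 * (B\<^sup>2 * (\<Sum>j\<le>k. (\<eta> j)\<^sup>2)) \<le> \<sigma>\<^sup>2 * A\<^sup>2"
    by (rule mult_left_mono) simp
  then have "B\<^sup>2 * N \<le> (\<sigma> * A)\<^sup>2"
    by (simp add: N_def power_mult_distrib mult.left_commute)
  then have N: "B\<^sup>2 * N \<le> C\<^sup>2 * D\<^sup>2 * E0"
    using E0 by (simp add: DE[symmetric] power_mult_distrib)
  \<comment> \<open>Only one of the two factors \<open>D\<close> is enlarged to \<open>B\<close>;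
    the other must survive to give the statistical term.\<close>
  have "B * (B * N) \<le> B * (C\<^sup>2 * D * E0)"
  proof -
    have "C\<^sup>2 * D\<^sup>2 * E0 = D * (C\<^sup>2 * D * E0)" by (simp add: power2_eq_square mult_ac)
    also have "\<dots> \<le> B * (C\<^sup>2 * D * E0)"
      using B D E0 by (intro mult_right_mono mult_nonneg_nonneg) auto
    finally show ?thesis using N by (simp add: power2_eq_square mult.assoc)
  qed
  then have BN: "B * N \<le> C\<^sup>2 * D * E0" using B by simp
  also have "\<dots> \<le> B * (C\<^sup>2 * E0)"
    using B E0 mult_right_mono[of D B "C\<^sup>2 * E0"] by (simp add: mult_ac)
  finally have N_le: "N \<le> C\<^sup>2 * E0" using B by simp
  have den: "0 < B + c * LH * n"
    using step_denominator(2)[of k] by (simp add: B_def c_def n_def)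
  have "\<mu> / 2 * (n * (n / (B + c * LH * n))) * R \<le> E0 + N"
    using R by (simp add: \<eta> B_def c_def n_def N_def)
  then have "\<mu> * n\<^sup>2 * R \<le> 2 * (E0 + N) * (B + c * LH * n)"
    using den by (simp add: field_simps power2_eq_square)
  also have "\<dots> = 2 * (4 * L * E0 + D * E0 + B * N + c * LH * n * (E0 + N))"
    by (simp add: B_def algebra_simps)
  also have "\<dots> \<le> 2 * (4 * L * E0 + D * E0 + C\<^sup>2 * D * E0 + c * LH * n * (E0 + C\<^sup>2 * E0))"
    using BN N_le c LH n L D by (intro mult_left_mono add_mono mult_nonneg_nonneg) auto
  also have "\<dots> = 8 * L * E0 + 2 * (1 + C\<^sup>2) * (D * E0) + 2 * c * (1 + C\<^sup>2) * LH * n * E0"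
    by (simp add: algebra_simps)
  \<comment> \<open>The choice of \<open>D\<close> balances the terms:
    \<open>(1 + C\<^sup>2) / C\<close> becomes \<open>C + 1 / C\<close>.\<close>
  also have "D * E0 = \<sigma> * A * sqrt E0 / C"
  proof -
    have "D * E0 = \<sigma> * A / C * (E0 / sqrt E0)" by (simp add: D_eq)
    then show ?thesis using E0 by (simp add: real_div_sqrt)
  qed
  also have "2 * (1 + C\<^sup>2) * (\<sigma> * A * sqrt E0 / C) = 2 * (C + 1 / C) * \<sigma> * sqrt E0 * A"
    using C by (simp add: field_simps power2_eq_square)
  also have "\<dots> \<le> 2 * (C + 1 / C) * \<sigma> * sqrt E0 * (n * sqrt n)"
    using A_le C \<sigma> E0 by (intro mult_left_mono mult_nonneg_nonneg add_nonneg_nonneg) auto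
  also have "2 * c * (1 + C\<^sup>2) * LH * n * E0 \<le> 7.4 * (1 + C\<^sup>2) * LH * n * E0"
  proof -
    \<comment> \<open>\<open>2 * c\<close> is \<open>4 * sqrt (2 + sqrt 2)\<close>, and 7.4 is 4
      times 1.85. The number 1.4225 is the square of 1.85 minus 2.\<close>
    have s: "sqrt 2 \<le> (1.4225::real)"
      by (rule real_le_lsqrt) (simp_all add: power2_eq_square)
    have "sqrt (2 + sqrt 2) \<le> (1.85::real)"
      using s by (intro real_le_lsqrt) (simp_all add: power2_eq_square)
    then have "2 * c \<le> 7.4" by (simp add: c_def)
    then show ?thesis
      using LH n E0 by (intro mult_right_mono mult_nonneg_nonneg) auto
  qed
  finally have "\<mu> * n\<^sup>2 * R \<le> 8 * L * E0 + 2 * (C + 1 / C) * \<sigma> * sqrt E0 * (n * sqrt n)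
      + 7.4 * (1 + C\<^sup>2) * LH * n * E0" by simp
  also have "\<dots> = \<mu> * n\<^sup>2 * ((8 * L / (\<mu> * n\<^sup>2) + 7.4 * (1 + C\<^sup>2) * LH / (\<mu> * n)) * E0
      + 2 * (C + 1 / C) * \<sigma> / (\<mu> * sqrt n) * sqrt E0)"
  proof -
    have "\<mu> * n\<^sup>2 * (8 * L / (\<mu> * n\<^sup>2) * E0) = 8 * L * E0"
      using n \<mu> by simp
    moreover have "\<mu> * n\<^sup>2 * (7.4 * (1 + C\<^sup>2) * LH / (\<mu> * n) * E0) = 7.4 * (1 + C\<^sup>2) * LH * n * E0"
      using n \<mu> by (simp add: power2_eq_square)
    moreover have "\<mu> * n\<^sup>2 * (2 * (C + 1 / C) * \<sigma> / (\<mu> * sqrt n) * sqrt E0)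
        = 2 * (C + 1 / C) * \<sigma> * sqrt E0 * (n * (n / sqrt n))"
      using \<mu> by (simp add: power2_eq_square)
    ultimately show ?thesis
      using real_div_sqrt[of n] n by (simp add: distrib_left distrib_right)
  qed
  finally show ?thesis
    using \<mu> n by (simp add: n_def[symmetric])
qed

end

theorem theorem4p1:
  fixes f :: "real ^ 'n \<Rightarrow> real"
    and g :: "real ^ 'm \<Rightarrow> real"
    and I :: "(real ^ 'n) \<times> (real ^ 'm) \<Rightarrow> real"
    and \<mu>f \<mu>g Lf Lg Ixx Ixy Iyy \<sigma>H \<sigma>F L \<mu> LH \<sigma> C A E0 D :: real
    and zstar :: "(real ^ 'n) \<times> (real ^ 'm)"
    and M :: "'w measure" and S :: "'s measure" and T :: "'t measure"
    and \<zeta> :: "nat \<Rightarrow> 'w \<Rightarrow> 's" and \<xi> :: "nat \<Rightarrow> 'w \<Rightarrow> 't"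
    and Ht :: "(real ^ 'n) \<times> (real ^ 'm) \<Rightarrow> 's \<Rightarrow> (real ^ 'n) \<times> (real ^ 'm)"
    and Ft :: "(real ^ 'n) \<times> (real ^ 'm) \<Rightarrow> 't \<Rightarrow> (real ^ 'n) \<times> (real ^ 'm)"
    and K :: nat
    and \<alpha> \<eta> :: "nat \<Rightarrow> real"
    and z zh zag zmd :: "nat \<Rightarrow> 'w \<Rightarrow> (real ^ 'n) \<times> (real ^ 'm)"
  assumes "0 < \<mu>f" and "strongly_convex \<mu>f f" and "smooth_fun Lf f"
    and "0 < \<mu>g" and "strongly_convex \<mu>g g" and "smooth_fun Lg g"
    and "twice_differentiable I"
    and "\<forall>y. convex_on UNIV (\<lambda>x. I (x, y))"
    and "\<forall>x. concave_on UNIV (\<lambda>y. I (x, y))"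
    and "\<forall>x y. onorm (hess_xx I x y) \<le> Ixx"
    and "\<forall>x y. onorm (hess_xy I x y) \<le> Ixy"
    and "\<forall>x y. onorm (hess_yy I x y) \<le> Iyy"
    and "grad (sep_sum f g) zstar + coupling_op I zstar = 0"
    and "prob_space M"
    and "\<forall>k. unbiased_oracle M S (\<zeta> k) Ht (coupling_op I) \<sigma>H"
    and "\<forall>k. unbiased_oracle M T (\<xi> k) Ft (grad (sep_sum f g)) \<sigma>F"
    and "indep_sources M (z 0) S \<zeta> T \<xi>"
    and "integrable M (\<lambda>\<omega>. (norm (z 0 \<omega>))\<^sup>2)"
    and "L = max Lf Lg" and "\<mu> = min \<mu>f \<mu>g" and "LH = max Ixx Iyy + Ixy"
    and "\<sigma> = sqrt (3 * sqrt 2 * \<sigma>H\<^sup>2 + 2 * \<sigma>F\<^sup>2)"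
    and "1 \<le> K" and "0 < C"
    and "A = sqrt ((real K + 1) * (real K + 2) * (2 * real K + 3) / 6)"
    and "E0 = (\<integral>\<omega>. (norm (z 0 \<omega> - zstar))\<^sup>2 \<partial>M)" and "0 < E0"
    and "D = \<sigma> / C * (A / sqrt E0)"
    and "\<forall>k. \<alpha> k = 2 / (real k + 2)"
    and "\<forall>k. \<eta> k = (real k + 2) / (4 * L + D + 2 * sqrt (2 + sqrt 2) * LH * (real k + 2))"
    and "\<forall>\<omega>\<in>space M. ag_og_run K \<alpha> \<eta> Ht Ft (\<lambda>k. \<zeta> k \<omega>) (\<lambda>k. \<xi> k \<omega>)
           (\<lambda>k. z k \<omega>) (\<lambda>k. zh k \<omega>) (\<lambda>k. zag k \<omega>) (\<lambda>k. zmd k \<omega>)"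
  shows "integrable M (\<lambda>\<omega>. (norm (zag K \<omega> - zstar))\<^sup>2) \<and>
    (\<integral>\<omega>. (norm (zag K \<omega> - zstar))\<^sup>2 \<partial>M)
      \<le> (8 * L / (\<mu> * (real K + 1)\<^sup>2) + 7.4 * (1 + C\<^sup>2) * LH / (\<mu> * (real K + 1))) * E0
        + 2 * (C + 1 / C) * \<sigma> / (\<mu> * sqrt (real K + 1)) * sqrt E0"
proof -
  have \<mu>: "0 < \<mu>" using assms(1,4,20) by simp
  have F: "strongly_convex \<mu> (sep_sum f g)" "smooth_fun L (sep_sum f g)"
    using strongly_convex_sep_sum[OF assms(2,5)] smooth_fun_sep_sum[OF assms(3,6)] assms(19,20)
    by simp_all
  have L: "0 < L"
    using \<mu> strong_convexity_le_smoothness[OF F] by linarith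
  have H: "LH-lipschitz_on UNIV (coupling_op I)"
    unfolding assms(21) by (rule coupling_op_lipschitz[OF assms(7,10,11,12)])
  have LH: "0 \<le> LH" by (rule lipschitz_on_nonneg[OF H])
  have \<sigma>: "0 \<le> \<sigma>" "\<sigma>\<^sup>2 = 3 * sqrt 2 * \<sigma>H\<^sup>2 + 2 * \<sigma>F\<^sup>2"
    using assms(22) by simp_all
  have "0 \<le> A" using assms(25) by simp
  then have D: "0 \<le> D"
    using \<sigma>(1) assms(24,27,28) by simp
  have \<eta>: "\<eta> k = (real k + 2) / (4 * L + D + 2 * sqrt (2 + sqrt 2) * LH * (real k + 2))" for k
    using assms(30) by blast
  have \<alpha>: "\<alpha> = (\<lambda>k. 2 / (real k + 2))" using assms(29) by blast
  note step = L LH D \<eta>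
  interpret prob_space M by (rule assms(14))
  interpret stochastic_ag_og M z S \<zeta> T \<xi> "sep_sum f g" "coupling_op I" \<mu> L LH \<sigma>H \<sigma>F Ht Ft K \<eta>
    zh zag zmd zstar
    by unfold_locales
      (use \<mu> F H assms(13,15-18,31) \<alpha> coupling_op_monotone[OF assms(7-9)]
        step_nonneg[OF step] step_le_L[OF step] step_le_LH[OF step] step_ratio[OF step] in auto)
  \<comment> \<open>The last step has index \<open>K - 1\<close>, so \<open>k + 2\<close> in the
    rate becomes \<open>K + 1\<close>.\<close>
  obtain k where K: "K = Suc k" using assms(23) by (cases K) auto
  note error = expected_error[of k, folded K, folded assms(26) \<sigma>(2)]
  show ?thesis
    using error step_size_rate[OF step \<mu> \<sigma>(1) assms(24,27) _ assms(28), of k] assms(25)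
    by (simp add: K add.commute)
qed

end
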